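(* Let $d \geq 1$ be an integer. There exists a function $f \in \bigcap_{p \in (1,\infty]} L^p(\mathbb{R}^d)$ and a compact set $E \subseteq \mathbb{R}^d$ of Hausdorff dimension $d$ such that no point of $E$ is a Lebesgue point of the Fourier transform $\hat f$.
   Context: A point $x \in \mathbb{R}^d$ is a Lebesgue point of a function $g \colon \mathbb{R}^d \to \mathbb{C}$ if there exists a number $c \in \mathbb{C}$ such that $r^{-d} \int_{\{|y|<r\}} |g(x-y)-c| \, dy \to 0$ as $r \to 0$. (Here $c$ need not equal $g(x)$, so the notion does not depend on the choice of representative of $g$ modulo null sets.) The Fourier transform of $f$ is understood in the usual sense for functions in $L^2(\mathbb{R}^d)$. *)

theory Defs
  imports "HOL-Analysis.Analysis"
begin

text \<open>
  \<open>Lp p\<close> is the set of functions (not of classes modulo null sets) representing the elements of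
  \<open>L\<^sup>p(\<real>\<^sup>d)\<close>, for \<open>1 \<le> p \<le> \<infinity>\<close>. Measurability is with respect to the Borel sets; every
  Lebesgue measurable function has a Borel representative. The integrals are \<open>ennreal\<close>-valued, so
  that finiteness is a genuine condition.
\<close>

definition Lp :: "ennreal \<Rightarrow> ('a::euclidean_space \<Rightarrow> complex) set" where
  "Lp p = {f \<in> borel_measurable lborel.
     if p = \<infinity> then \<exists>C. AE x in lborel. norm (f x) \<le> C
     else (\<integral>\<^sup>+x. ennreal (norm (f x) powr enn2real p) \<partial>lborel) < \<infinity>}"

definition tendsto_L2 :: "(nat \<Rightarrow> 'a::euclidean_space \<Rightarrow> complex) \<Rightarrow> ('a \<Rightarrow> complex) \<Rightarrow> bool" where
  "tendsto_L2 u v \<longleftrightarrow>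
     (\<lambda>n. \<integral>\<^sup>+x. ennreal ((norm (u n x - v x))\<^sup>2) \<partial>lborel) \<longlonglongrightarrow> 0"

definition fourier_L1 :: "('a::euclidean_space \<Rightarrow> complex) \<Rightarrow> 'a \<Rightarrow> complex" where
  "fourier_L1 f \<xi> = (LINT x|lborel. cis (- 2 * pi * (x \<bullet> \<xi>)) * f x)"

text \<open>
  The Fourier transform on \<open>L\<^sup>2\<close> is the continuous extension of \<^const>\<open>fourier_L1\<close> from the dense
  subspace \<open>L\<^sup>1 \<inter> L\<^sup>2\<close>, i.e. the closure of its graph. By Plancherel's theorem, for
  \<open>f\<close> in \<open>L\<^sup>2\<close> such a \<open>g\<close> exists, does not depend on the approximating sequence, and is unique
  up to a null set. Being defined only up to null sets, the transform is given as a relation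
  between representatives.
\<close>

definition has_fourier_L2 :: "('a::euclidean_space \<Rightarrow> complex) \<Rightarrow> ('a \<Rightarrow> complex) \<Rightarrow> bool" where
  "has_fourier_L2 f g \<longleftrightarrow> f \<in> Lp 2 \<and> g \<in> Lp 2 \<and>
     (\<exists>h. (\<forall>n. h n \<in> Lp 1 \<inter> Lp 2) \<and> tendsto_L2 h f \<and> tendsto_L2 (\<lambda>n. fourier_L1 (h n)) g)"

definition lebesgue_point :: "('a::euclidean_space \<Rightarrow> complex) \<Rightarrow> 'a \<Rightarrow> bool" where
  "lebesgue_point g x \<longleftrightarrow>
     (\<exists>c. ((\<lambda>r. (\<integral>\<^sup>+y\<in>ball 0 r. ennreal (norm (g (x - y) - c)) \<partial>lborel) / ennreal (r ^ DIM('a)))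
        \<longlongrightarrow> 0) (at_right 0))"

text \<open>
  The covering sets are required to be bounded because \<^const>\<open>diameter\<close> has no meaningful
  value on unbounded sets. Empty covering sets contribute \<open>0\<close>, so finite covers are included.
\<close>

definition hausdorff_premeasure :: "real \<Rightarrow> real \<Rightarrow> 'a::metric_space set \<Rightarrow> ennreal" where
  "hausdorff_premeasure s \<delta> E =
     (INF U \<in> {U :: nat \<Rightarrow> 'a set. E \<subseteq> (\<Union>i. U i) \<and> (\<forall>i. bounded (U i) \<and> diameter (U i) \<le> \<delta>)}.
        \<Sum>i. ennreal (diameter (U i) powr s))"

definition hausdorff_outer_measure :: "real \<Rightarrow> 'a::metric_space set \<Rightarrow> ennreal" where
  "hausdorff_outer_measure s E = (SUP \<delta>\<in>{0<..}. hausdorff_premeasure s \<delta> E)"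

text \<open>
  The exponent \<open>s = 0\<close> is left out of the infimum because \<open>0 powr 0 = 0\<close>; this does not change
  the infimum.
\<close>

definition hausdorff_dimension :: "'a::metric_space set \<Rightarrow> ennreal" where
  "hausdorff_dimension E = Inf {ennreal s |s. 0 < s \<and> hausdorff_outer_measure s E = 0}"

end

theory Submission
  imports Defs "HOL-Probability.Characteristic_Functions" "HOL-Library.Discrete_Functions"
begin

text \<open>
  Fix a unit coordinate vector \<open>b\<close> and rapidly increasing frequencies \<open>\<omega> k\<close>. Let \<open>g k\<close> be the Gaussian
  times the Riesz product of the factors \<open>(1 + cos (2 \<pi> \<omega> j (x \<bullet> b))) / 2\<close> for \<open>j < k\<close>, and let \<open>f k\<close> be its
  Fourier transform, a convex combination of translated Gaussians. Then \<open>f k\<close> has integral \<open>1\<close> and is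
  bounded by \<open>2 (3/4)^k\<close>, so that the series of the \<open>f k\<close> converges in every \<open>L p\<close> with \<open>p > 1\<close>; and
  \<open>g k\<close> has values in \<open>[0, 1]\<close> and integral \<open>f k 0 \<le> 2 (3/4)^k\<close>, so that the series of the \<open>g k\<close> converges
  in \<open>L 2\<close>. The sum of the \<open>f k\<close> is the counterexample. Let \<open>E\<close> be the compact set of the points of the unit
  cube at which all the Riesz products are at least \<open>1/2\<close>. At a point of \<open>E\<close> the partial sums of the
  continuous nonnegative functions \<open>g k\<close> tend to infinity, hence so do the averages of the sum over small
  balls.

  The set \<open>E\<close> contains all \<open>x\<close> for which \<open>\<omega> k (x \<bullet> b)\<close> is very close to an integer for all \<open>k\<close>. With powers of
  two as frequencies this holds as soon as a certain sparse set of binary digits of \<open>x \<bullet> b\<close> vanishes.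
  Inserting zeros at these places maps the open unit cube into \<open>E\<close>, and since the inserted digits have
  density zero, the inverse of this map is Hoelder continuous of every exponent below \<open>1\<close>. This yields
  the full Hausdorff dimension.
\<close>

subsection \<open>The Fourier transform of the Gaussian\<close>

text \<open>Lebesgue measure is the image of the product of one-dimensional Lebesgue measures under
  the coordinate map, so Fubini's theorem for finite products applies.\<close>

lemma integrable_lborel_prod:
  fixes f :: "'a::euclidean_space \<Rightarrow> real \<Rightarrow> 'b::{real_normed_field,banach,second_countable_topology}"
  assumes "\<And>b. b \<in> Basis \<Longrightarrow> integrable lborel (f b)"
  shows "integrable lborel (\<lambda>x::'a. \<Prod>b\<in>Basis. f b (x \<bullet> b))"
    and integral_lborel_prod:
      "(LINT x|lborel. (\<Prod>b\<in>Basis. f b (x \<bullet> b))) = (\<Prod>b\<in>Basis. LINT t|lborel. f b t)"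
proof -
  have meas [measurable]: "\<And>b. b \<in> Basis \<Longrightarrow> f b \<in> borel_measurable borel"
    using borel_measurable_integrable[OF assms] by simp
  interpret product_sigma_finite "\<lambda>_::'a. lborel :: real measure" ..
  have eq: "(\<Prod>b\<in>Basis. f b ((\<Sum>c\<in>Basis. z c *\<^sub>R c) \<bullet> b)) = (\<Prod>b\<in>Basis. f b (z b))" for z :: "'a \<Rightarrow> real"
    by (intro prod.cong refl) simp
  show "integrable lborel (\<lambda>x::'a. \<Prod>b\<in>Basis. f b (x \<bullet> b))"
    unfolding lborel_eq[where 'a='a]
    by (subst integrable_distr_eq) (auto simp: eq intro!: product_integrable_prod assms)
  show "(LINT x|lborel. (\<Prod>b\<in>Basis. f b (x \<bullet> b))) = (\<Prod>b\<in>Basis. LINT t|lborel. f b t)"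
    unfolding lborel_eq[where 'a='a]
    by (subst integral_distr) (auto simp: eq intro!: product_integral_prod assms)
qed

text \<open>The factor \<open>pi\<close> makes this function its own Fourier transform in the
  normalisation of \<open>fourier_L1\<close>.\<close>

definition gauss :: "'a::euclidean_space \<Rightarrow> real" where
  "gauss x = exp (- pi * (norm x)\<^sup>2)"

lemma gauss_pos: "0 < gauss x" and gauss_le_1: "gauss x \<le> 1"
  by (simp_all add: gauss_def)

lemma continuous_gauss [continuous_intros]: "continuous_on S gauss"
  unfolding gauss_def[abs_def] by (intro continuous_intros)

lemma measurable_gauss [measurable]: "gauss \<in> borel_measurable borel"
  by (intro borel_measurable_continuous_onI continuous_gauss)

lemma gauss_eq_prod: "gauss x = (\<Prod>b\<in>Basis. gauss (x \<bullet> b))"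
proof -
  have "(norm x)\<^sup>2 = (\<Sum>b\<in>Basis. (x \<bullet> b)\<^sup>2)"
    unfolding power2_norm_eq_inner by (subst euclidean_inner) (simp add: power2_eq_square)
  then show ?thesis
    by (simp add: gauss_def exp_sum[symmetric] sum_distrib_left sum_negf)
qed

lemma has_bochner_integral_gauss_real:
  fixes \<xi> :: real
  shows "has_bochner_integral lborel (\<lambda>x. cis (- 2 * pi * (x * \<xi>)) * of_real (gauss x)) (of_real (gauss \<xi>))"
proof -
  \<comment> \<open>Substituting \<open>s * x\<close> for \<open>x\<close> turns the standard normal
    density into \<open>gauss x / s\<close>, and its characteristic function at \<open>t\<close>
    into the Fourier integral at \<open>\<xi>\<close>.\<close>
  define s where "s = sqrt (2 * pi)"
  define t where "t = - s * \<xi>"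
  have s: "s > 0" "s\<^sup>2 = 2 * pi"
    by (auto simp: s_def)
  let ?h = "\<lambda>x. std_normal_density x *\<^sub>R iexp (t * x)"
  have int: "integrable lborel ?h"
    by (rule Bochner_Integration.integrable_bound[where f=std_normal_density])
      (auto intro!: integrable_normal_density)
  have "(LINT x|std_normal_distribution. iexp (t * x)) = of_real (exp (- (t^2) / 2))"
    using fun_cong[OF char_std_normal_distribution, of t] by (simp add: char_def)
  then have "(LINT x|lborel. ?h x) = of_real (exp (- (t^2) / 2))"
    by (subst (asm) integral_density) auto
  then have "has_bochner_integral lborel ?h (of_real (exp (- (t^2) / 2)))"
    using int by (simp add: has_bochner_integral_iff)
  then have *: "has_bochner_integral lborel (\<lambda>x. ?h (0 + s * x)) (of_real (exp (- (t^2) / 2)) /\<^sub>R \<bar>s\<bar>)"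
    using s by (subst (asm) lborel_has_bochner_integral_real_affine_iff[where c=s and t=0]) auto
  have "t\<^sup>2 / 2 = pi * \<xi>\<^sup>2"
    by (simp add: t_def power_mult_distrib s)
  then have g: "exp (- (t^2) / 2) = gauss \<xi>"
    by (simp add: gauss_def)
  have h: "s *\<^sub>R ?h (0 + s * x) = cis (- 2 * pi * (x * \<xi>)) * of_real (gauss x)" for x
  proof -
    have "std_normal_density (0 + s * x) = gauss x / s"
      by (simp add: std_normal_density_def gauss_def power_mult_distrib s) (simp add: s_def)
    moreover have "t * (s * x) = - 2 * pi * (x * \<xi>)"
      using s(2) by (simp add: t_def power2_eq_square algebra_simps)
    then have "iexp (t * (0 + s * x)) = cis (- 2 * pi * (x * \<xi>))"
      by (simp add: cis_conv_exp flip: of_real_mult)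
    ultimately show ?thesis
      using s(1) by (simp add: scaleR_conv_of_real)
  qed
  show ?thesis
    using has_bochner_integral_scaleR_right[OF *, of s] s(1) unfolding h g by simp
qed

lemma has_bochner_integral_gauss:
  fixes \<xi> :: "'a::euclidean_space"
  shows "has_bochner_integral lborel (\<lambda>x. cis (- 2 * pi * (x \<bullet> \<xi>)) * of_real (gauss x)) (of_real (gauss \<xi>))"
proof -
  let ?f = "\<lambda>(b::'a) (t::real). cis (- 2 * pi * (t * (\<xi> \<bullet> b))) * of_real (gauss t)"
  have cis_sum: "cis (\<Sum>b\<in>B. h b) = (\<Prod>b\<in>B. cis (h b))" if "finite B" for B and h :: "'a \<Rightarrow> real"
    using that by induction (simp_all flip: cis_mult)
  have eq: "(\<Prod>b\<in>Basis. ?f b (x \<bullet> b)) = cis (- 2 * pi * (x \<bullet> \<xi>)) * of_real (gauss x)" for x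
    by (subst euclidean_inner[of x], subst gauss_eq_prod[of x])
      (simp add: cis_sum prod.distrib sum_distrib_left)
  have int: "integrable lborel (?f b)" and val: "(LINT t|lborel. ?f b t) = of_real (gauss (\<xi> \<bullet> b))" for b
    using has_bochner_integral_gauss_real[of "\<xi> \<bullet> b"] by (simp_all add: has_bochner_integral_iff)
  show ?thesis
    using integrable_lborel_prod[of ?f, OF int] integral_lborel_prod[of ?f, OF int]
    unfolding eq val by (simp add: has_bochner_integral_iff gauss_eq_prod[of \<xi>])
qed

lemma has_bochner_integral_lborel_translation:
  fixes f :: "'a::euclidean_space \<Rightarrow> 'b::{banach,second_countable_topology}"
  assumes "has_bochner_integral lborel f I"
  shows "has_bochner_integral lborel (\<lambda>x. f (x + c)) I"
proof -
  have [measurable]: "f \<in> borel_measurable borel"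
    using borel_measurable_has_bochner_integral[OF assms] by simp
  have "has_bochner_integral (distr lborel borel ((+) c)) f I"
    using assms by (simp add: lborel_distr_plus)
  then show ?thesis
    by (subst (asm) has_bochner_integral_iff, subst (asm) integrable_distr_eq, simp, simp,
        subst (asm) integral_distr, simp_all add: has_bochner_integral_iff add.commute)
qed

subsection \<open>Riesz products times the Gaussian\<close>

definition riesz :: "'a::euclidean_space \<Rightarrow> (nat \<Rightarrow> real) \<Rightarrow> nat \<Rightarrow> 'a \<Rightarrow> real" where
  "riesz b \<omega> k x = (\<Prod>j<k. (1 + cos (2 * pi * \<omega> j * (x \<bullet> b))) / 2)"

definition spec :: "'a::euclidean_space \<Rightarrow> (nat \<Rightarrow> real) \<Rightarrow> nat \<Rightarrow> 'a \<Rightarrow> real" where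
  "spec b \<omega> k x = riesz b \<omega> k x * gauss x"

text \<open>This is \<open>f k\<close> of the overview, \<open>spec\<close> being
  \<open>g k\<close>. Each step convolves with the measure of mass \<open>1/2\<close> at the origin
  and \<open>1/4\<close> at each of the two points \<open>\<omega> k *\<^sub>R b\<close> and
  \<open>- \<omega> k *\<^sub>R b\<close>, the Fourier transform of the new Riesz factor.\<close>

primrec wave :: "'a::euclidean_space \<Rightarrow> (nat \<Rightarrow> real) \<Rightarrow> nat \<Rightarrow> 'a \<Rightarrow> real" where
  "wave b \<omega> 0 x = gauss x"
| "wave b \<omega> (Suc k) x =
     wave b \<omega> k x / 2 + (wave b \<omega> k (x + \<omega> k *\<^sub>R b) + wave b \<omega> k (x + - \<omega> k *\<^sub>R b)) / 4"

lemma riesz_nonneg: "0 \<le> riesz b \<omega> k x" and riesz_le_1: "riesz b \<omega> k x \<le> 1"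
proof -
  have "0 \<le> (1 + cos t) / 2" "(1 + cos t) / 2 \<le> 1" for t :: real
  proof -
    have "0 \<le> 1 + cos t" using cos_ge_minus_one[of t] by linarith
    then show "0 \<le> (1 + cos t) / 2" by simp
    show "(1 + cos t) / 2 \<le> 1" using cos_le_one[of t] by simp
  qed
  then show "0 \<le> riesz b \<omega> k x" "riesz b \<omega> k x \<le> 1"
    unfolding riesz_def by (auto intro!: prod_nonneg prod_le_1)
qed

lemma spec_nonneg: "0 \<le> spec b \<omega> k x" and spec_le_1: "spec b \<omega> k x \<le> 1"
  using riesz_nonneg[of b \<omega> k x] riesz_le_1[of b \<omega> k x] gauss_pos[of x] gauss_le_1[of x]
  by (auto simp: spec_def mult_le_one)

lemma spec_0: "spec b \<omega> k 0 = 1"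
  by (simp add: spec_def riesz_def gauss_def)

lemma continuous_riesz [continuous_intros]: "continuous_on S (riesz b \<omega> k)"
  unfolding riesz_def[abs_def] by (intro continuous_intros) auto

lemma continuous_spec [continuous_intros]: "continuous_on S (spec b \<omega> k)"
  unfolding spec_def[abs_def] by (intro continuous_intros)

lemma measurable_spec [measurable]: "spec b \<omega> k \<in> borel_measurable borel"
  by (intro borel_measurable_continuous_onI continuous_spec)

lemma measurable_wave [measurable]: "wave b \<omega> k \<in> borel_measurable borel"
  by (induction k) (simp_all)

lemma wave_nonneg: "0 \<le> wave b \<omega> k x"
  by (induction k arbitrary: x) (auto simp: less_imp_le[OF gauss_pos])

text \<open>Expanding the cosine into exponentials turns the new factor into a combination of
  modulations, which the Fourier transform exchanges with the translations in
  \<open>wave\<close>.\<close>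

lemma spec_Suc: "complex_of_real (spec b \<omega> (Suc k) x) = of_real (spec b \<omega> k x) *
    (1 / 2 + cis (2 * pi * \<omega> k * (x \<bullet> b)) / 4 + cis (- (2 * pi * \<omega> k * (x \<bullet> b))) / 4)"
  by (auto simp: spec_def riesz_def complex_eq_iff field_simps)

text \<open>A translation by \<open>c\<close> multiplies the transform by a character, and the
  characters of the three translations add up to the new Riesz factor.\<close>

lemma has_bochner_integral_wave:
  fixes \<xi> b :: "'a::euclidean_space"
  shows "has_bochner_integral lborel (\<lambda>x. cis (- 2 * pi * (x \<bullet> \<xi>)) * of_real (wave b \<omega> k x))
    (of_real (spec b \<omega> k \<xi>))"
proof (induction k)
  case 0
  then show ?case
    using has_bochner_integral_gauss[of \<xi>] by (simp add: spec_def riesz_def)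
next
  case (Suc k)
  let ?h = "\<lambda>x. cis (- 2 * pi * (x \<bullet> \<xi>)) * of_real (wave b \<omega> k x)"
  have shift: "has_bochner_integral lborel (\<lambda>x. cis (- 2 * pi * (x \<bullet> \<xi>)) * of_real (wave b \<omega> k (x + c)))
      (cis (2 * pi * (c \<bullet> \<xi>)) * of_real (spec b \<omega> k \<xi>))" for c
  proof -
    have "cis (2 * pi * (c \<bullet> \<xi>)) * ?h (x + c) = cis (- 2 * pi * (x \<bullet> \<xi>)) * of_real (wave b \<omega> k (x + c))" for x
      unfolding mult.assoc[symmetric] cis_mult by (simp add: inner_add_left algebra_simps)
    then show ?thesis
      using has_bochner_integral_mult_right[OF has_bochner_integral_lborel_translation[OF Suc, of c],
          of "cis (2 * pi * (c \<bullet> \<xi>))"] by (simp only:)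
  qed
  have comb: "has_bochner_integral M (\<lambda>x. (1/2) * u x + ((1/4) * v x + (1/4) * w x)) (1/2 * I + (1/4 * J + 1/4 * K))"
    if "has_bochner_integral M u I" "has_bochner_integral M v J" "has_bochner_integral M w K"
    for M and u v w :: "'a \<Rightarrow> complex" and I J K
    by (intro has_bochner_integral_add has_bochner_integral_mult_right that)
  show ?case
    by (rule has_bochner_integral_cong[THEN iffD1, OF refl _ _
          comb[OF Suc shift[of "\<omega> k *\<^sub>R b"] shift[of "- \<omega> k *\<^sub>R b"]]])
      (simp_all add: spec_Suc field_simps inner_commute[of b])
qed

text \<open>This direction has its own induction and avoids Fourier inversion. A modulation of the
  integrand moves \<open>\<xi>\<close>, hence the induction is over all \<open>\<xi>\<close>. The
  case \<open>\<xi> = 0\<close> yields the integral of \<open>spec\<close>.\<close>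

lemma has_bochner_integral_spec:
  fixes \<xi> b :: "'a::euclidean_space"
  shows "has_bochner_integral lborel (\<lambda>x. cis (- 2 * pi * (x \<bullet> \<xi>)) * of_real (spec b \<omega> k x))
    (of_real (wave b \<omega> k \<xi>))"
proof (induction k arbitrary: \<xi>)
  case 0
  then show ?case
    using has_bochner_integral_gauss[of \<xi>] by (simp add: spec_def riesz_def)
next
  case (Suc k)
  let ?h = "\<lambda>\<xi> x. cis (- 2 * pi * (x \<bullet> \<xi>)) * of_real (spec b \<omega> k x)"
  have comb: "has_bochner_integral M (\<lambda>x. (1/2) * u x + ((1/4) * v x + (1/4) * w x)) (1/2 * I + (1/4 * J + 1/4 * K))"
    if "has_bochner_integral M u I" "has_bochner_integral M v J" "has_bochner_integral M w K"
    for M and u v w :: "'a \<Rightarrow> complex" and I J K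
    by (intro has_bochner_integral_add has_bochner_integral_mult_right that)
  have sh: "?h (\<xi> + c *\<^sub>R b) x = ?h \<xi> x * cis (- (2 * pi * c * (x \<bullet> b)))" for c x
  proof -
    have "cis (- 2 * pi * (x \<bullet> (\<xi> + c *\<^sub>R b))) = cis (- 2 * pi * (x \<bullet> \<xi>)) * cis (- (2 * pi * c * (x \<bullet> b)))"
      unfolding cis_mult by (simp add: inner_add_right algebra_simps)
    then show ?thesis by simp
  qed
  show ?case
    by (rule has_bochner_integral_cong[THEN iffD1, OF refl _ _
          comb[OF Suc Suc[of "\<xi> + \<omega> k *\<^sub>R b"] Suc[of "\<xi> + - \<omega> k *\<^sub>R b"]]])
      (simp_all only: sh spec_Suc, simp_all add: field_simps)
qed

lemma fourier_L1_wave: "fourier_L1 (\<lambda>x. of_real (wave b \<omega> k x)) = (\<lambda>\<xi>. of_real (spec b \<omega> k \<xi>))"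
  using has_bochner_integral_integral_eq[OF has_bochner_integral_wave]
  by (auto simp: fourier_L1_def fun_eq_iff)

lemma integrable_cis_wave: "integrable lborel (\<lambda>x. cis (- 2 * pi * (x \<bullet> \<xi>)) * of_real (wave b \<omega> k x))"
  using has_bochner_integral_wave by (rule integrable.intros)

lemma nn_integral_wave: "(\<integral>\<^sup>+x. ennreal (wave b \<omega> k x) \<partial>lborel) = 1"
proof -
  have "has_bochner_integral lborel (wave b \<omega> k) 1"
    using has_bochner_integral_Re[OF has_bochner_integral_wave[of 0 b \<omega> k]] by (simp add: spec_0)
  then show ?thesis
    by (subst nn_integral_eq_integral) (auto simp: has_bochner_integral_iff wave_nonneg)
qed

lemma nn_integral_spec: "(\<integral>\<^sup>+x. ennreal (spec b \<omega> k x) \<partial>lborel) = ennreal (wave b \<omega> k 0)"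
proof -
  have "has_bochner_integral lborel (spec b \<omega> k) (wave b \<omega> k 0)"
    using has_bochner_integral_Re[OF has_bochner_integral_spec[of 0 b \<omega> k]] by simp
  then show ?thesis
    by (subst nn_integral_eq_integral) (auto simp: has_bochner_integral_iff spec_nonneg)
qed

subsection \<open>Sums of functions with geometrically decaying norms\<close>

text \<open>
  Instead of Minkowski's inequality, the proof uses that \<open>u k \<le> s\<^sup>1\<^sup>/\<^sup>p r\<^sup>k\<close> pointwise, where
  \<open>s\<close> is the sum of the functions \<open>(u k / r\<^sup>k)\<^sup>p\<close>.
\<close>

lemma geometric_Lp_sum:
  fixes u :: "nat \<Rightarrow> 'a \<Rightarrow> real" and p q C :: real
  assumes p: "0 < p" and q: "0 < q" "q < 1" and C: "0 \<le> C"
    and meas [measurable]: "\<And>k. u k \<in> borel_measurable M"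
    and nonneg: "\<And>k x. 0 \<le> u k x"
    and bound: "\<And>k. (\<integral>\<^sup>+x. ennreal (u k x powr p) \<partial>M) \<le> ennreal (C * q ^ k)"
  shows "AE x in M. summable (\<lambda>k. u k x)"
    and "(\<integral>\<^sup>+x. ennreal ((\<Sum>k. u k x) powr p) \<partial>M)
      \<le> ennreal ((1 / (1 - sqrt q powr (1 / p))) powr p / (1 - sqrt q) * C)"
proof -
  \<comment> \<open>The decay is split in two halves: as \<open>\<rho> * \<rho> = q\<close>, the
    \<open>p\<close>-th powers divided by \<open>\<rho> ^ k\<close> still have summable integrals,
    and the factor taken out becomes \<open>r ^ k\<close> after the \<open>p\<close>-th
    root.\<close>
  define \<rho> where "\<rho> = sqrt q"
  define r where "r = \<rho> powr (1 / p)"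
  have \<rho>: "0 < \<rho>" "\<rho> < 1" "\<rho> * \<rho> = q"
    using q by (auto simp: \<rho>_def)
  have r: "0 < r" "r < 1" "r powr p = \<rho>"
    using \<rho> p powr_less_mono2[of "1 / p" \<rho> 1] by (auto simp: r_def powr_powr)
  define S where "S x = (\<Sum>k. ennreal (u k x powr p / \<rho> ^ k))" for x
  have [measurable]: "S \<in> borel_measurable M"
    unfolding S_def by measurable
  have "(\<integral>\<^sup>+x. S x \<partial>M) = (\<Sum>k. \<integral>\<^sup>+x. ennreal (u k x powr p / \<rho> ^ k) \<partial>M)"
    unfolding S_def by (intro nn_integral_suminf) measurable
  also have "\<dots> \<le> (\<Sum>k. ennreal (C * \<rho> ^ k))"
  proof (intro suminf_le summableI)
    fix k
    have "(\<integral>\<^sup>+x. ennreal (u k x powr p / \<rho> ^ k) \<partial>M)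
        = (\<integral>\<^sup>+x. ennreal (1 / \<rho> ^ k) * ennreal (u k x powr p) \<partial>M)"
      using \<rho>(1,2) by (intro nn_integral_cong) (simp add: ennreal_mult[symmetric])
    also have "\<dots> = ennreal (1 / \<rho> ^ k) * (\<integral>\<^sup>+x. ennreal (u k x powr p) \<partial>M)"
      by (intro nn_integral_cmult) measurable
    also have "\<dots> \<le> ennreal (1 / \<rho> ^ k) * ennreal (C * q ^ k)"
      by (intro mult_left_mono bound) simp
    also have "\<dots> = ennreal (C * \<rho> ^ k)"
    proof -
      have "q ^ k = \<rho> ^ k * \<rho> ^ k"
        unfolding power_mult_distrib[symmetric] \<rho>(3) ..
      then show ?thesis
        using \<rho>(1) C by (simp add: ennreal_mult[symmetric])
    qed
    finally show "(\<integral>\<^sup>+x. ennreal (u k x powr p / \<rho> ^ k) \<partial>M) \<le> ennreal (C * \<rho> ^ k)" .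
  qed
  also have "\<dots> = ennreal (C / (1 - \<rho>))"
  proof (rule suminf_ennreal_eq)
    show "(\<lambda>k. C * \<rho> ^ k) sums (C / (1 - \<rho>))"
      using sums_mult[OF geometric_sums, of \<rho> C] \<rho>(1,2) by simp
  qed (use \<rho>(1) C in simp)
  finally have int_S: "(\<integral>\<^sup>+x. S x \<partial>M) \<le> ennreal (C / (1 - \<rho>))" .
  then have "(\<integral>\<^sup>+x. S x \<partial>M) \<noteq> \<infinity>"
    by (simp add: neq_top_trans[OF ennreal_neq_top])
  then have fin: "AE x in M. S x \<noteq> \<infinity>"
    by (intro nn_integral_noteq_infinite) measurable
  have key: "summable (\<lambda>k. u k x) \<and> ennreal ((\<Sum>k. u k x) powr p) \<le> ennreal ((1 / (1 - r)) powr p) * S x"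
    if finite: "S x \<noteq> \<infinity>" for x
  proof -
    obtain s where s: "S x = ennreal s" "0 \<le> s"
      using finite by (cases "S x") auto
    have le: "u k x \<le> s powr (1 / p) * r ^ k" for k
    proof -
      have "ennreal (u k x powr p / \<rho> ^ k) \<le> S x"
        unfolding S_def
        using sum_le_suminf[of "\<lambda>k. ennreal (u k x powr p / \<rho> ^ k)" "{k}"] by simp
      then have "u k x powr p / \<rho> ^ k \<le> s"
        unfolding s(1) by (simp only: ennreal_le_iff[OF s(2)])
      then have "u k x powr p \<le> s * \<rho> ^ k"
        using \<rho>(1) by (simp only: pos_divide_le_eq zero_less_power)
      then have "(u k x powr p) powr (1 / p) \<le> (s * \<rho> ^ k) powr (1 / p)"
        using p by (intro powr_mono2) auto
      also have "(u k x powr p) powr (1 / p) = u k x"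
        using p nonneg by (simp add: powr_powr)
      also have "(s * \<rho> ^ k) powr (1 / p) = s powr (1 / p) * r ^ k"
      proof -
        have "(\<rho> ^ k) powr (1 / p) = (\<rho> powr real k) powr (1 / p)"
          by (simp only: powr_realpow[OF \<rho>(1)])
        also have "\<dots> = r powr real k"
          by (simp add: r_def powr_powr)
        also have "\<dots> = r ^ k"
          by (rule powr_realpow[OF r(1)])
        finally show ?thesis
          using s \<rho>(1,2) by (simp add: powr_mult)
      qed
      finally show ?thesis .
    qed
    have geo: "(\<lambda>k. s powr (1 / p) * r ^ k) sums (s powr (1 / p) * (1 / (1 - r)))"
      using r by (intro sums_mult geometric_sums) auto
    have summ: "summable (\<lambda>k. u k x)"
      by (rule summable_comparison_test'[OF sums_summable[OF geo]]) (use le nonneg in auto)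
    have "(\<Sum>k. u k x) \<le> s powr (1 / p) * (1 / (1 - r))"
      using suminf_le[OF le summ sums_summable[OF geo]] sums_unique[OF geo] by simp
    then have "(\<Sum>k. u k x) powr p \<le> (s powr (1 / p) * (1 / (1 - r))) powr p"
      using p suminf_nonneg[OF summ] nonneg by (intro powr_mono2) auto
    also have "\<dots> = (1 / (1 - r)) powr p * s"
      using p r s by (subst powr_mult) (auto simp: powr_powr)
    finally have "ennreal ((\<Sum>k. u k x) powr p) \<le> ennreal ((1 / (1 - r)) powr p * s)"
      by (rule ennreal_leI)
    then show ?thesis
      using summ s by (simp add: ennreal_mult)
  qed
  from fin show "AE x in M. summable (\<lambda>k. u k x)"
    by (rule eventually_mono) (use key in blast)
  have "(\<integral>\<^sup>+x. ennreal ((\<Sum>k. u k x) powr p) \<partial>M) \<le> (\<integral>\<^sup>+x. ennreal ((1 / (1 - r)) powr p) * S x \<partial>M)"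
    by (intro nn_integral_mono_AE eventually_mono[OF fin]) (use key in blast)
  also have "\<dots> = ennreal ((1 / (1 - r)) powr p) * (\<integral>\<^sup>+x. S x \<partial>M)"
    by (intro nn_integral_cmult) measurable
  also have "\<dots> \<le> ennreal ((1 / (1 - r)) powr p) * ennreal (C / (1 - \<rho>))"
    by (intro mult_left_mono int_S) simp
  also have "\<dots> = ennreal ((1 / (1 - r)) powr p / (1 - \<rho>) * C)"
    using \<rho>(1,2) C by (simp add: ennreal_mult[symmetric])
  finally show "(\<integral>\<^sup>+x. ennreal ((\<Sum>k. u k x) powr p) \<partial>M)
      \<le> ennreal ((1 / (1 - sqrt q powr (1 / p))) powr p / (1 - sqrt q) * C)"
    by (simp add: r_def \<rho>_def)
qed

text \<open>The tail starting at index \<open>n\<close> satisfies the hypotheses of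
  \<open>geometric_Lp_sum\<close> with \<open>C * q ^ n\<close> for \<open>C\<close>, and the bound
  obtained there is linear in that constant.\<close>

lemma tendsto_L2_suminf:
  fixes u :: "nat \<Rightarrow> 'a::euclidean_space \<Rightarrow> real" and q C :: real
  assumes q: "0 < q" "q < 1" and C: "0 \<le> C"
    and meas [measurable]: "\<And>k. u k \<in> borel_measurable borel"
    and nonneg: "\<And>k x. 0 \<le> u k x"
    and bound: "\<And>k. (\<integral>\<^sup>+x. ennreal (u k x powr 2) \<partial>lborel) \<le> ennreal (C * q ^ k)"
  shows "tendsto_L2 (\<lambda>n x. of_real (\<Sum>k<n. u k x)) (\<lambda>x. of_real (\<Sum>k. u k x))"
proof -
  define K where "K = (1 / (1 - sqrt q powr (1 / 2))) powr 2 / (1 - sqrt q)"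
  have le: "(\<integral>\<^sup>+x. ennreal ((norm (complex_of_real (\<Sum>k<n. u k x) - complex_of_real (\<Sum>k. u k x)))\<^sup>2) \<partial>lborel)
      \<le> ennreal (K * (C * q ^ n))" for n
  proof -
    have summ: "AE x in lborel. summable (\<lambda>k. u k x)"
      by (rule geometric_Lp_sum(1)[where p=2 and q=q and C=C]) (use assms in auto)
    have "(\<integral>\<^sup>+x. ennreal ((norm (complex_of_real (\<Sum>k<n. u k x) - complex_of_real (\<Sum>k. u k x)))\<^sup>2) \<partial>lborel)
        = (\<integral>\<^sup>+x. ennreal ((\<Sum>k. u (k + n) x) powr 2) \<partial>lborel)"
    proof (intro nn_integral_cong_AE AE_mp[OF summ AE_I2] impI)
      fix x assume s: "summable (\<lambda>k. u k x)"
      have eq: "(\<Sum>k<n. u k x) - (\<Sum>k. u k x) = - (\<Sum>k. u (k + n) x)"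
        using suminf_split_initial_segment[OF s, of n] by simp
      have "0 \<le> (\<Sum>k. u (k + n) x)"
        using s by (intro suminf_nonneg nonneg summable_ignore_initial_segment)
      then show "ennreal ((norm (complex_of_real (\<Sum>k<n. u k x) - complex_of_real (\<Sum>k. u k x)))\<^sup>2)
          = ennreal ((\<Sum>k. u (k + n) x) powr 2)"
        unfolding of_real_diff[symmetric] eq by (simp add: powr_numeral)
    qed
    also have "\<dots> \<le> ennreal (K * (C * q ^ n))"
    proof -
      have "(\<integral>\<^sup>+x. ennreal (u (k + n) x powr 2) \<partial>lborel) \<le> ennreal ((C * q ^ n) * q ^ k)" for k
        using bound[of "k + n"] by (simp add: power_add mult_ac)
      then show ?thesis
        unfolding K_def using q C by (intro geometric_Lp_sum(2)) (simp_all add: nonneg)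
    qed
    finally show ?thesis .
  qed
  have "(\<lambda>n. ennreal (K * (C * q ^ n))) \<longlonglongrightarrow> ennreal (K * (C * 0))"
    using q by (intro tendsto_ennrealI tendsto_mult tendsto_const LIMSEQ_realpow_zero) auto
  then have lim: "(\<lambda>n. ennreal (K * (C * q ^ n))) \<longlonglongrightarrow> 0"
    by simp
  show ?thesis
    unfolding tendsto_L2_def
    by (rule tendsto_sandwich[OF _ _ tendsto_const lim]) (simp_all only: le zero_le eventually_True)
qed

subsection \<open>Bounds on the Hausdorff dimension\<close>

lemma hausdorff_premeasure_finite_cover:
  fixes U :: "'i \<Rightarrow> 'a::metric_space set"
  assumes "finite I" and "E \<subseteq> (\<Union>i\<in>I. U i)" and "0 \<le> \<delta>"
    and "\<And>i. i \<in> I \<Longrightarrow> bounded (U i) \<and> diameter (U i) \<le> \<delta>"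
  shows "hausdorff_premeasure s \<delta> E \<le> (\<Sum>i\<in>I. ennreal (diameter (U i) powr s))"
proof -
  obtain h where h: "bij_betw h {..<card I} I"
    using ex_bij_betw_nat_finite[OF \<open>finite I\<close>] by (auto simp: atLeast0LessThan)
  \<comment> \<open>Padding with empty sets costs nothing, since they have diameter \<open>0\<close>
    and \<open>0 powr s = 0\<close>.\<close>
  define V where "V n = (if n < card I then U (h n) else {})" for n
  have "h n \<in> I" if "n < card I" for n
    using h that by (auto simp: bij_betw_def)
  then have "\<forall>n. bounded (V n) \<and> diameter (V n) \<le> \<delta>"
    using assms by (auto simp: V_def)
  moreover have "E \<subseteq> (\<Union>n. V n)"
  proof
    fix x assume "x \<in> E"
    then obtain i where "i \<in> I" "x \<in> U i"
      using assms by blast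
    moreover then obtain n where "n < card I" "i = h n"
      using h by (auto simp: bij_betw_def)
    ultimately show "x \<in> (\<Union>n. V n)"
      by (auto simp: V_def intro!: exI[of _ n])
  qed
  ultimately have "hausdorff_premeasure s \<delta> E \<le> (\<Sum>n. ennreal (diameter (V n) powr s))"
    unfolding hausdorff_premeasure_def by (intro INF_lower) auto
  also have "\<dots> = (\<Sum>n<card I. ennreal (diameter (V n) powr s))"
    by (intro suminf_finite) (auto simp: V_def)
  also have "\<dots> = (\<Sum>n<card I. ennreal (diameter (U (h n)) powr s))"
    by (simp add: V_def)
  also have "\<dots> = (\<Sum>i\<in>I. ennreal (diameter (U i) powr s))"
    by (rule sum.reindex_bij_betw[OF h])
  finally show ?thesis .
qed

text \<open>With \<open>d\<close> the dimension, a grid of mesh \<open>1/N\<close> covers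
  \<open>E\<close> by \<open>(2 R N)^d\<close> cubes of diameter at most \<open>d/N\<close>. The
  resulting sum \<open>bnd N\<close> is of order \<open>N^(d - s)\<close> and tends to
  \<open>0\<close>.\<close>

lemma hausdorff_outer_measure_eq_0:
  fixes E :: "'a::euclidean_space set"
  assumes "bounded E" and s: "real DIM('a) < s"
  shows "hausdorff_outer_measure s E = 0"
proof -
  let ?d = "DIM('a)"
  obtain B where B: "\<And>x. x \<in> E \<Longrightarrow> norm x < B"
    using \<open>bounded E\<close> by (meson bounded_pos_less)
  obtain R :: nat where R: "B \<le> real R"
    using real_arch_simple by blast
  have "hausdorff_premeasure s \<delta> E = 0" if "0 < \<delta>" for \<delta>
  proof -
    define bnd where "bnd N = (2 * real R) ^ ?d * real ?d powr s * real N powr (real ?d - s)" for N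
    have bnd: "hausdorff_premeasure s \<delta> E \<le> ennreal (bnd N)" if N: "real ?d / \<delta> \<le> real N" "0 < N" for N
    proof -
      define I :: "('a \<Rightarrow> int) set" where "I = Basis \<rightarrow>\<^sub>E {- int (R * N)..<int (R * N)}"
      define U where "U f = {x::'a. \<forall>i\<in>Basis. of_int (f i) \<le> real N * (x \<bullet> i) \<and> real N * (x \<bullet> i) < of_int (f i) + 1}"
        for f :: "'a \<Rightarrow> int"
      have dist: "norm (x - y) \<le> real ?d / real N" if "x \<in> U f" "y \<in> U f" for x y f
      proof -
        have "\<bar>(x - y) \<bullet> i\<bar> \<le> 1 / real N" if i: "i \<in> Basis" for i
        proof -
          have "\<bar>real N * (x \<bullet> i) - real N * (y \<bullet> i)\<bar> \<le> 1"
            using \<open>x \<in> U f\<close> \<open>y \<in> U f\<close> i by (force simp: U_def)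
          then have "real N * \<bar>(x - y) \<bullet> i\<bar> \<le> 1"
            by (simp add: inner_diff_left abs_mult flip: right_diff_distrib)
          then show ?thesis using N by (simp add: field_simps)
        qed
        then have "(\<Sum>i\<in>Basis. \<bar>(x - y) \<bullet> i\<bar>) \<le> real ?d * (1 / real N)"
          by (rule sum_bounded_above)
        with norm_le_l1[of "x - y"] show ?thesis by simp
      qed
      have diam: "diameter (U f) \<le> real ?d / real N" for f
        by (rule diameter_le) (use dist in auto)
      have bdd: "bounded (U f)" for f
        using dist by (auto simp: bounded_two_points dist_norm)
      have cover: "E \<subseteq> (\<Union>f\<in>I. U f)"
      proof
        fix x assume "x \<in> E"
        define f where "f = (\<lambda>i\<in>Basis. \<lfloor>real N * (x \<bullet> i)\<rfloor>)"
        have "f i \<in> {- int (R * N)..<int (R * N)}" if i: "i \<in> Basis" for i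
        proof -
          have "\<bar>x \<bullet> i\<bar> < real R"
            using Basis_le_norm[OF i, of x] B[OF \<open>x \<in> E\<close>] R by linarith
          then have "\<bar>real N * (x \<bullet> i)\<bar> < real N * real R"
            using N by (simp add: abs_mult)
          then show ?thesis
            using i by (simp add: f_def le_floor_iff floor_less_iff mult.commute abs_less_iff)
        qed
        then have "f \<in> I"
          by (auto simp: I_def f_def)
        moreover have "x \<in> U f"
          by (auto simp: U_def f_def)
        ultimately show "x \<in> (\<Union>f\<in>I. U f)" by blast
      qed
      have "finite I"
        by (auto simp: I_def intro: finite_PiE)
      have "hausdorff_premeasure s \<delta> E \<le> (\<Sum>f\<in>I. ennreal (diameter (U f) powr s))"
      proof (rule hausdorff_premeasure_finite_cover[OF \<open>finite I\<close> cover])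
        have "real ?d / real N \<le> \<delta>"
          using N \<open>0 < \<delta>\<close> by (simp add: field_simps)
        then show "bounded (U f) \<and> diameter (U f) \<le> \<delta>" for f
          using bdd[of f] diam[of f] by auto
      qed (use \<open>0 < \<delta>\<close> in auto)
      also have "\<dots> \<le> (\<Sum>f\<in>I. ennreal ((real ?d / real N) powr s))"
        using s by (intro sum_mono ennreal_leI powr_mono2 diam) (auto simp: diameter_ge_0 bdd)
      also have "\<dots> = ennreal (real (card I) * (real ?d / real N) powr s)"
        by (simp add: ennreal_mult ennreal_of_nat_eq_real_of_nat)
      also have "real (card I) = (2 * real R * real N) ^ ?d"
        by (simp add: I_def card_PiE flip: mult_2) (simp add: mult_ac power_mult_distrib)
      also have "\<dots> * (real ?d / real N) powr s = bnd N"
        using N by (simp add: bnd_def powr_divide powr_diff powr_realpow power_mult_distrib)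
      finally show ?thesis .
    qed
    have "\<forall>\<^sub>F N in sequentially. real ?d / \<delta> \<le> real N"
      using filterlim_real_sequentially by (auto simp: filterlim_at_top)
    then have "\<forall>\<^sub>F N in sequentially. hausdorff_premeasure s \<delta> E \<le> ennreal (bnd N)"
      using eventually_gt_at_top[of 0] by eventually_elim (use bnd in blast)
    moreover have "(\<lambda>N. ennreal (bnd N)) \<longlonglongrightarrow> ennreal ((2 * real R) ^ ?d * real ?d powr s * 0)"
      unfolding bnd_def using s
      by (intro tendsto_ennrealI tendsto_intros tendsto_neg_powr filterlim_real_sequentially) auto
    ultimately show ?thesis
      using tendsto_lowerbound[of "\<lambda>N. ennreal (bnd N)" 0 sequentially] by simp
  qed
  then show ?thesis
    unfolding hausdorff_outer_measure_def by simp
qed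

lemma hausdorff_dimension_le_DIM:
  fixes E :: "'a::euclidean_space set"
  assumes "bounded E"
  shows "hausdorff_dimension E \<le> of_nat DIM('a)"
proof (rule ennreal_le_epsilon)
  fix e :: real assume "0 < e"
  have "hausdorff_dimension E \<le> ennreal (real DIM('a) + e)"
    unfolding hausdorff_dimension_def
    using hausdorff_outer_measure_eq_0[OF assms, of "real DIM('a) + e"] \<open>0 < e\<close>
    by (intro Inf_lower CollectI exI[of _ "real DIM('a) + e"]) (auto intro: add_pos_pos)
  then show "hausdorff_dimension E \<le> of_nat DIM('a) + ennreal e"
    using \<open>0 < e\<close> by (simp add: ennreal_plus ennreal_of_nat_eq_real_of_nat)
qed

text \<open>By \<open>expand\<close>, the inverse of \<open>\<Psi>\<close> is Hoelder continuous of
  exponent \<open>s\<close>. A cover of \<open>E\<close> therefore pulls back to a cover of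
  \<open>A\<close> by balls of radius \<open>C * diameter (U i) powr s\<close>, whose volumes must
  add up to at least that of \<open>A\<close>.\<close>

lemma hausdorff_outer_measure_pos:
  fixes \<Psi> :: "'a::euclidean_space \<Rightarrow> 'b::metric_space"
  assumes A [measurable]: "A \<in> sets lborel" and pos: "0 < emeasure lborel A" and "\<Psi> ` A \<subseteq> E"
    and s: "0 < s" and C: "0 < C"
    and expand: "\<And>t t'. t \<in> A \<Longrightarrow> t' \<in> A \<Longrightarrow> dist t t' \<le> C * dist (\<Psi> t) (\<Psi> t') powr s"
  shows "0 < hausdorff_outer_measure (s * DIM('a)) E"
proof -
  define K where "K = unit_ball_vol (real DIM('a)) * C ^ DIM('a)"
  have K: "0 < K"
    using C by (simp add: K_def)
  have "emeasure lborel A / ennreal K \<le> (\<Sum>i. ennreal (diameter (U i) powr (s * DIM('a))))"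
    if cov: "E \<subseteq> (\<Union>i. U i)" and bdd: "\<And>i. bounded (U i)" for U :: "nat \<Rightarrow> 'b set"
  proof -
    define T where "T i = A \<inter> \<Psi> -` U i" for i
    \<comment> \<open>\<open>T i\<close> need not be measurable, as nothing is assumed about
      \<open>U i\<close> and the measurability of \<open>\<Psi>\<close>. A ball centred at any of
      its points contains it.\<close>
    define B where "B i = (if T i = {} then {} else cball (SOME t. t \<in> T i) (C * diameter (U i) powr s))" for i
    have TB: "T i \<subseteq> B i" for i
    proof
      fix t assume t: "t \<in> T i"
      define t0 where "t0 = (SOME t. t \<in> T i)"
      have t0: "t0 \<in> T i"
        unfolding t0_def using t by (rule someI)
      have "dist t0 t \<le> C * dist (\<Psi> t0) (\<Psi> t) powr s"
        using t t0 by (intro expand) (auto simp: T_def)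
      also have "\<dots> \<le> C * diameter (U i) powr s"
        using t t0 C s bdd[of i]
        by (intro mult_left_mono powr_mono2 diameter_bounded_bound) (auto simp: T_def)
      finally show "t \<in> B i"
        using t by (auto simp: B_def t0_def)
    qed
    have "A \<subseteq> (\<Union>i. T i)"
      using cov \<open>\<Psi> ` A \<subseteq> E\<close> by (force simp: T_def)
    then have "A \<subseteq> (\<Union>i. B i)"
      using TB by blast
    then have "emeasure lborel A \<le> emeasure lborel (\<Union>i. B i)"
      by (intro emeasure_mono) (auto simp: B_def)
    also have "\<dots> \<le> (\<Sum>i. emeasure lborel (B i))"
      by (intro emeasure_subadditive_countably) (auto simp: B_def)
    also have "\<dots> \<le> (\<Sum>i. ennreal (diameter (U i) powr (s * DIM('a))) * ennreal K)"
    proof (intro suminf_le summableI)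
      fix i
      have "(C * diameter (U i) powr s) ^ DIM('a) = C ^ DIM('a) * diameter (U i) powr (s * DIM('a))"
        by (simp add: power_mult_distrib powr_powr flip: powr_realpow')
      then have "emeasure lborel (cball t (C * diameter (U i) powr s)) = ennreal (diameter (U i) powr (s * DIM('a)) * K)"
        for t :: 'a
        using C by (subst emeasure_cball) (auto simp: K_def mult_ac)
      then show "emeasure lborel (B i) \<le> ennreal (diameter (U i) powr (s * DIM('a))) * ennreal K"
        using K by (auto simp: B_def ennreal_mult)
    qed
    also have "\<dots> = (\<Sum>i. ennreal (diameter (U i) powr (s * DIM('a)))) * ennreal K"
      by simp
    finally show ?thesis
      using K by (intro divide_le_posI_ennreal) (auto simp: mult.commute)
  qed
  then have "emeasure lborel A / ennreal K \<le> hausdorff_premeasure (s * DIM('a)) 1 E"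
    unfolding hausdorff_premeasure_def by (intro INF_greatest) auto
  also have "\<dots> \<le> hausdorff_outer_measure (s * DIM('a)) E"
    unfolding hausdorff_outer_measure_def by (intro SUP_upper) auto
  finally show ?thesis
    using pos by (auto simp: ennreal_zero_less_divide elim!: less_le_trans[rotated])
qed

lemma hausdorff_dimension_eq_DIM:
  fixes \<Psi> :: "'a::euclidean_space \<Rightarrow> 'a"
  assumes "bounded E"
    and A: "A \<in> sets lborel" "0 < emeasure lborel A" and "\<Psi> ` A \<subseteq> E"
    and expand: "\<And>s. 0 < s \<Longrightarrow> s < 1 \<Longrightarrow>
      \<exists>C>0. \<forall>t\<in>A. \<forall>t'\<in>A. dist t t' \<le> C * dist (\<Psi> t) (\<Psi> t') powr s"
  shows "hausdorff_dimension E = of_nat DIM('a)"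
proof (rule antisym)
  show "hausdorff_dimension E \<le> of_nat DIM('a)"
    by (rule hausdorff_dimension_le_DIM) fact
  show "of_nat DIM('a) \<le> hausdorff_dimension E"
    unfolding hausdorff_dimension_def
  proof (rule Inf_greatest, clarify)
    fix \<sigma> :: real assume \<sigma>: "0 < \<sigma>" "hausdorff_outer_measure \<sigma> E = 0"
    have "real DIM('a) \<le> \<sigma>"
    proof (rule ccontr)
      assume "\<not> real DIM('a) \<le> \<sigma>"
      \<comment> \<open>For this exponent \<open>hausdorff_outer_measure_pos\<close> speaks about
        the dimension \<open>\<sigma>\<close>, and it lies below \<open>1\<close> by the assumption
        to be refuted.\<close>
      then have s: "0 < \<sigma> / real DIM('a)" "\<sigma> / real DIM('a) < 1"
        using \<sigma> by (auto simp: field_simps)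
      obtain C where "C > 0" "\<forall>t\<in>A. \<forall>t'\<in>A. dist t t' \<le> C * dist (\<Psi> t) (\<Psi> t') powr (\<sigma> / real DIM('a))"
        using expand[OF s] by blast
      then have "0 < hausdorff_outer_measure (\<sigma> / real DIM('a) * real DIM('a)) E"
        using s A \<open>\<Psi> ` A \<subseteq> E\<close> by (intro hausdorff_outer_measure_pos[where A=A and \<Psi>=\<Psi>]) auto
      with \<sigma> show False by simp
    qed
    then show "of_nat DIM('a) \<le> ennreal \<sigma>"
      by (simp add: ennreal_of_nat_eq_real_of_nat)
  qed
qed

subsection \<open>Inserting zeros into binary expansions\<close>

definition digit :: "nat \<Rightarrow> real \<Rightarrow> real" where
  "digit k t = of_int (\<lfloor>2 ^ k * t\<rfloor> mod 2)"

lemma digit_bounds: "0 \<le> digit k t" "digit k t \<le> 1"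
proof -
  have "0 \<le> \<lfloor>2 ^ k * t\<rfloor> mod 2" "\<lfloor>2 ^ k * t\<rfloor> mod 2 \<le> 1"
    by presburger+
  then show "0 \<le> digit k t" "digit k t \<le> 1"
    unfolding digit_def by (simp_all only: of_int_0_le_iff of_int_le_1_iff)
qed

text \<open>The weight \<open>(1/2)^i\<close> of the binary digit number \<open>i\<close> is
  replaced by \<open>a i\<close>. The sum starts with digit \<open>1\<close>, the first one after
  the binary point.\<close>

definition spread :: "(nat \<Rightarrow> real) \<Rightarrow> real \<Rightarrow> real" where
  "spread a t = (\<Sum>k. a (Suc k) * digit (Suc k) t)"

text \<open>Under this condition all digits after the \<open>i\<close>-th contribute at most
  \<open>a i\<close> together, as in an ordinary binary expansion, so that \<open>spread a\<close>
  respects the order of digit sequences.\<close>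

locale halving =
  fixes a :: "nat \<Rightarrow> real"
  assumes a_pos: "\<And>i. 0 < a i" and a_Suc: "\<And>i. 2 * a (Suc i) \<le> a i"
begin

definition head :: "nat \<Rightarrow> real \<Rightarrow> real" where
  "head i t = (\<Sum>k<i. a (Suc k) * digit (Suc k) t)"

lemma tail_terms: "0 \<le> a (Suc (k + i)) * digit (Suc (k + i)) t"
    "a (Suc (k + i)) * digit (Suc (k + i)) t \<le> a i * ((1 / 2) ^ Suc k)"
proof -
  have "a (k + i) \<le> a i * (1 / 2) ^ k" for k
  proof (induction k)
    case (Suc k)
    then show ?case using a_Suc[of "k + i"] by simp
  qed simp
  from this[of "Suc k"] have *: "a (Suc (k + i)) \<le> a i * (1 / 2) ^ Suc k" by simp
  show "0 \<le> a (Suc (k + i)) * digit (Suc (k + i)) t"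
    by (intro mult_nonneg_nonneg digit_bounds less_imp_le[OF a_pos])
  have "a (Suc (k + i)) * digit (Suc (k + i)) t \<le> a (Suc (k + i)) * 1"
    by (intro mult_left_mono digit_bounds less_imp_le[OF a_pos])
  with * show "a (Suc (k + i)) * digit (Suc (k + i)) t \<le> a i * ((1 / 2) ^ Suc k)"
    by linarith
qed

lemma geometric_tail: "(\<lambda>k. a i * ((1 / 2) ^ Suc k)) sums a i"
  using sums_mult[OF power_half_series, of "a i"] by simp

lemma summable_tail: "summable (\<lambda>k. a (Suc (k + i)) * digit (Suc (k + i)) t)"
  by (rule summable_comparison_test'[OF sums_summable[OF geometric_tail[of i]], of 0])
    (simp only: real_norm_def abs_of_nonneg[OF tail_terms(1)] tail_terms(2))

lemma head_le_spread: "head i t \<le> spread a t" and spread_le_head: "spread a t \<le> head i t + a i"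
proof -
  define R where "R = (\<Sum>k. a (Suc (k + i)) * digit (Suc (k + i)) t)"
  have eq: "spread a t = head i t + R"
    unfolding spread_def head_def R_def
    using suminf_split_initial_segment[OF summable_tail[of 0 t], of i] by (simp only: add_0_right)
  have "0 \<le> R"
    unfolding R_def by (intro suminf_nonneg summable_tail tail_terms)
  moreover have "R \<le> a i"
    unfolding R_def
    using suminf_le[OF tail_terms(2) summable_tail sums_summable[OF geometric_tail]] sums_unique[OF geometric_tail, of i] by metis
  ultimately show "head i t \<le> spread a t" "spread a t \<le> head i t + a i"
    using eq by auto
qed

lemma spread_bounds: "0 \<le> spread a t" "spread a t \<le> a 0"
  using head_le_spread[of 0 t] spread_le_head[of t 0] by (auto simp: head_def)

lemma floor_half: "\<lfloor>2 ^ i * t\<rfloor> = \<lfloor>2 ^ Suc i * t\<rfloor> div 2" for t :: real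
proof -
  have "2 ^ i * t = (2 ^ Suc i * t) / real_of_int 2" by simp
  then show ?thesis
    by (simp only: floor_divide_real_eq_div[of 2])
qed

text \<open>Induction on the number of digits. If the shorter prefixes agree, the last digits are
  \<open>0\<close> and \<open>1\<close>. Otherwise the gap \<open>a i\<close> is at least
  \<open>2 * a (Suc i)\<close>, and the last digits take away at most \<open>a (Suc i)\<close> of
  it.\<close>

lemma head_gap:
  assumes "0 \<le> t" "t < 1" "0 \<le> t'" "t' < 1" and "\<lfloor>2 ^ i * t\<rfloor> < \<lfloor>2 ^ i * t'\<rfloor>"
  shows "head i t + a i \<le> head i t'"
  using assms(5)
proof (induction i)
  case 0
  moreover have "\<lfloor>t\<rfloor> = 0" "\<lfloor>t'\<rfloor> = 0"
    using assms(1-4) by (simp_all add: floor_eq_iff)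
  ultimately show ?case by simp
next
  case (Suc i)
  define n where "n = \<lfloor>2 ^ Suc i * t\<rfloor>"
  define n' where "n' = \<lfloor>2 ^ Suc i * t'\<rfloor>"
  have "n < n'" using Suc.prems by (simp add: n_def n'_def)
  have head_Suc: "head (Suc i) t = head i t + a (Suc i) * of_int (n mod 2)"
      "head (Suc i) t' = head i t' + a (Suc i) * of_int (n' mod 2)"
    by (simp_all add: head_def digit_def n_def n'_def)
  show ?case
  proof (cases "n div 2 = n' div 2")
    case True
    have same: "head j t = head j t'" if "\<lfloor>2 ^ j * t\<rfloor> = \<lfloor>2 ^ j * t'\<rfloor>" for j
      using that
    proof (induction j)
      case (Suc j)
      have "\<lfloor>2 ^ j * t\<rfloor> = \<lfloor>2 ^ j * t'\<rfloor>"
        using Suc.prems floor_half by metis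
      with Suc show ?case
        by (simp add: head_def digit_def)
    qed (simp add: head_def)
    have "head i t = head i t'"
      by (rule same) (use True floor_half[of i t] floor_half[of i t'] in \<open>simp add: n_def n'_def del: power_Suc\<close>)
    moreover have "n mod 2 = 0 \<and> n' mod 2 = 1"
      using True \<open>n < n'\<close> by presburger
    ultimately show ?thesis
      by (simp add: head_Suc)
  next
    case False
    then have "n div 2 < n' div 2"
      using \<open>n < n'\<close> by presburger
    then have "head i t + a i \<le> head i t'"
      using floor_half[of i t] floor_half[of i t']
      by (intro Suc.IH) (simp add: n_def n'_def del: power_Suc)
    moreover have "a (Suc i) * of_int (n mod 2) \<le> a (Suc i) * 1" "0 \<le> a (Suc i) * of_int (n' mod 2)"
      using a_pos[of "Suc i"] by (auto intro!: mult_left_mono)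
    ultimately show ?thesis
      using a_Suc[of i] by (simp add: head_Suc)
  qed
qed

text \<open>A single step of \<open>1 / 2 ^ i\<close> gives a gap of \<open>a i\<close> between the
  heads, which the remaining digits of the smaller point may consume. Two steps leave one
  \<open>a i\<close> over.\<close>

lemma spread_gap:
  assumes t: "0 \<le> t" "t' < 1" and gap: "t + 2 / 2 ^ i \<le> t'"
  shows "spread a t + a i \<le> spread a t'"
proof -
  have pos: "0 < 2 / (2 ^ i :: real)" "0 < 1 / (2 ^ i :: real)" by auto
  have "2 / (2 ^ i :: real) = 1 / 2 ^ i + 1 / 2 ^ i" by simp
  with pos gap have u: "t + 1 / 2 ^ i < t'" by linarith
  have "\<lfloor>2 ^ i * (t + 1 / 2 ^ i)\<rfloor> = \<lfloor>2 ^ i * t\<rfloor> + 1" "\<lfloor>2 ^ i * t\<rfloor> + 2 = \<lfloor>2 ^ i * (t + 2 / 2 ^ i)\<rfloor>"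
    by (simp_all add: algebra_simps)
  moreover have "\<lfloor>2 ^ i * (t + 2 / 2 ^ i)\<rfloor> \<le> \<lfloor>2 ^ i * t'\<rfloor>"
    using gap by (intro floor_mono mult_left_mono) auto
  ultimately have "head i t + a i \<le> head i (t + 1 / 2 ^ i)" "head i (t + 1 / 2 ^ i) + a i \<le> head i t'"
    using t u pos by (intro head_gap; linarith)+
  then show ?thesis
    using spread_le_head[of t i] head_le_spread[of i t'] by linarith
qed

text \<open>The least \<open>i\<close> with \<open>2 / 2 ^ i \<le> y - x\<close> is chosen. Then
  \<open>spread_gap\<close> bounds the distance of the images below by \<open>a i\<close>, while
  minimality bounds \<open>y - x\<close> above by \<open>4 / 2 ^ i\<close>.\<close>

lemma spread_expand:
  assumes s: "0 < s" and C: "\<And>i. (1 / 2) ^ i \<le> C * a i powr s"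
    and t: "0 \<le> t" "t < 1" "0 \<le> t'" "t' < 1"
  shows "\<bar>t - t'\<bar> \<le> 4 * C * \<bar>spread a t - spread a t'\<bar> powr s"
proof -
  have "0 < C * a 0 powr s"
    using C[of 0] by (simp add: less_le_trans[OF zero_less_one])
  then have "0 < C"
    using a_pos[of 0] by (simp add: zero_less_mult_iff)
  have main: "y - x \<le> 4 * C * \<bar>spread a x - spread a y\<bar> powr s"
    if xy: "0 \<le> x" "x < y" "y < 1" for x y
  proof -
    let ?P = "\<lambda>i. 2 / 2 ^ i \<le> y - x"
    have "\<exists>i. ?P i"
      using real_arch_pow_inv[of "(y - x) / 2" "1 / 2"] xy
      by (auto simp: power_one_over field_simps intro: less_imp_le)
    define i where "i = (LEAST i. ?P i)"
    have i: "?P i"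
      unfolding i_def using \<open>\<exists>i. ?P i\<close> by (rule LeastI_ex)
    \<comment> \<open>The index is not \<open>0\<close>, because
      \<open>y - x < 1 < 2\<close>.\<close>
    then obtain j where j: "i = Suc j"
      using xy by (cases i) auto
    have "\<not> ?P j"
      using not_less_Least[of j ?P] j by (simp add: i_def)
    then have "y - x \<le> 4 * (1 / 2) ^ i"
      using j by (simp add: power_one_over field_simps)
    also have "\<dots> \<le> 4 * (C * a i powr s)"
      using C[of i] by simp
    also have "a i powr s \<le> \<bar>spread a x - spread a y\<bar> powr s"
      using spread_gap[of x y i] i xy a_pos[of i] s by (intro powr_mono2) auto
    finally show ?thesis
      using \<open>0 < C\<close> by simp
  qed
  show ?thesis
    using main[of t t'] main[of t' t] t \<open>0 < C\<close> by (cases t t' rule: linorder_cases) (auto simp: abs_minus_commute)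
qed

text \<open>Multiplication by \<open>l\<close> makes the first \<open>i\<close> terms integers. The
  next digit and everything after it contribute at most \<open>a (Suc i)\<close> each.\<close>

lemma spread_near_integer:
  assumes int: "\<And>k. k < i \<Longrightarrow> l * a (Suc k) \<in> \<int>" and l: "0 \<le> l"
  obtains n :: int where "\<bar>l * spread a t - of_int n\<bar> \<le> 2 * (l * a (Suc i))"
proof -
  have "l * head i t \<in> \<int>"
    unfolding head_def sum_distrib_left mult.assoc[symmetric]
    by (auto simp: digit_def intro!: Ints_sum Ints_mult int)
  then obtain n where n: "l * head i t = of_int n"
    by (auto elim: Ints_cases)
  have "head (Suc i) t \<le> head i t + a (Suc i)"
    using mult_left_mono[OF digit_bounds(2)[of "Suc i" t] less_imp_le[OF a_pos[of "Suc i"]]]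
    by (simp add: head_def)
  then have "spread a t \<le> head i t + 2 * a (Suc i)"
    using spread_le_head[of t "Suc i"] by simp
  from mult_left_mono[OF this l] mult_left_mono[OF head_le_spread[of i t] l] show ?thesis
    by (intro that[of n]) (auto simp: n distrib_left)
qed

end

subsection \<open>Decay of the waves\<close>

lemma abs_inner_translate_ge: "\<bar>(x + c *\<^sub>R b) \<bullet> b\<bar> \<ge> \<bar>x \<bullet> b\<bar> - \<bar>c\<bar>" if "b \<in> Basis" for x b :: "'a::euclidean_space"
  using that by (simp add: inner_add_left)

text \<open>\<open>wave b \<omega> k\<close> is an average of Gaussians translated along
  \<open>b\<close> by at most the sum of the first \<open>k\<close> frequencies.\<close>

lemma wave_le_translated_gauss:
  assumes b: "b \<in> Basis" and \<omega>: "\<And>k. 0 \<le> \<omega> k"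
  shows "wave b \<omega> k x \<le> exp (- pi * (max 0 (\<bar>x \<bullet> b\<bar> - (\<Sum>j<k. \<omega> j)))\<^sup>2)"
proof (induction k arbitrary: x)
  case 0
  have "(x \<bullet> b)\<^sup>2 \<le> (norm x)\<^sup>2"
    using Basis_le_norm[OF b, of x] by (simp add: abs_le_square_iff[symmetric])
  then show ?case by (simp add: gauss_def)
next
  case (Suc k)
  define e where "e = exp (- pi * (max 0 (\<bar>x \<bullet> b\<bar> - (\<Sum>j<Suc k. \<omega> j)))\<^sup>2)"
  have "wave b \<omega> k (x + c *\<^sub>R b) \<le> e" if "\<bar>c\<bar> \<le> \<omega> k" for c
  proof (rule order_trans[OF Suc])
    have "max 0 (\<bar>x \<bullet> b\<bar> - (\<Sum>j<Suc k. \<omega> j)) \<le> max 0 (\<bar>(x + c *\<^sub>R b) \<bullet> b\<bar> - (\<Sum>j<k. \<omega> j))"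
      using abs_inner_translate_ge[OF b, of x c] that by simp
    then have "(max 0 (\<bar>x \<bullet> b\<bar> - (\<Sum>j<Suc k. \<omega> j)))\<^sup>2 \<le> (max 0 (\<bar>(x + c *\<^sub>R b) \<bullet> b\<bar> - (\<Sum>j<k. \<omega> j)))\<^sup>2"
      by (intro power_mono) auto
    then show "exp (- pi * (max 0 (\<bar>(x + c *\<^sub>R b) \<bullet> b\<bar> - (\<Sum>j<k. \<omega> j)))\<^sup>2) \<le> e"
      by (simp add: e_def)
  qed
  from this[of 0] this[of "\<omega> k"] this[of "- \<omega> k"] \<omega>[of k] show ?case
    unfolding e_def[symmetric] wave.simps scaleR_zero_left add_0_right by argo
qed

text \<open>
  At most one of the three points in the recursion for \<open>wave (Suc k)\<close> is close to the frequencies of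
  \<open>wave k\<close>, and its coefficient is at most \<open>1/2\<close>.
\<close>

lemma wave_le_geometric:
  assumes b: "b \<in> Basis" and \<omega>: "\<And>k. 2 * (\<Sum>j<k. \<omega> j) + 2 * real k \<le> \<omega> k"
  shows "wave b \<omega> k x \<le> 2 * (3 / 4) ^ k"
proof (induction k arbitrary: x)
  case 0
  then show ?case using gauss_le_1[of x] by simp
next
  case (Suc k)
  have nonneg: "0 \<le> \<omega> k" for k
  proof (induction k rule: less_induct)
    case (less k)
    then have "0 \<le> (\<Sum>j<k. \<omega> j)" by (intro sum_nonneg) auto
    then show ?case using \<omega>[of k] by linarith
  qed
  \<comment> \<open>Such a point is at distance at least \<open>k\<close> from all the centres of
    the translated Gaussians, since half of \<open>\<omega> k\<close> exceeds the sum of the earlier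
    frequencies by at least \<open>k\<close>.\<close>
  have far: "wave b \<omega> k y \<le> (3 / 4) ^ k" if y: "\<omega> k / 2 \<le> \<bar>y \<bullet> b\<bar>" for y
  proof -
    have "real k \<le> max 0 (\<bar>y \<bullet> b\<bar> - (\<Sum>j<k. \<omega> j))"
      using \<omega>[of k] y by linarith
    then have "real k * real k \<le> (max 0 (\<bar>y \<bullet> b\<bar> - (\<Sum>j<k. \<omega> j)))\<^sup>2"
      unfolding power2_eq_square by (intro mult_mono) auto
    moreover have "real k \<le> real k * real k"
      by (cases k) auto
    ultimately have "1 * real k \<le> pi * (max 0 (\<bar>y \<bullet> b\<bar> - (\<Sum>j<k. \<omega> j)))\<^sup>2"
      using pi_gt3 by (intro mult_mono) auto
    then have "wave b \<omega> k y \<le> exp (- real k)"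
      using wave_le_translated_gauss[of b \<omega> k y, OF b nonneg]
      by (elim order_trans) simp
    also have "\<dots> = exp (- 1) ^ k"
      by (simp add: exp_of_nat_mult[symmetric])
    also have "\<dots> \<le> (3 / 4) ^ k"
    proof (rule power_mono)
      have "2 \<le> exp (1::real)" using exp_ge_add_one_self[of 1] by simp
      then show "exp (- 1) \<le> (3 / 4 :: real)" by (simp add: exp_minus field_simps)
    qed simp
    finally show ?thesis .
  qed
  let ?q = "(3 / 4) ^ k :: real" and ?c = "\<omega> k" and ?w = "wave b \<omega> k"
  have dot: "(x + c *\<^sub>R b) \<bullet> b = x \<bullet> b + c" for c
    using b by (simp add: inner_add_left)
  have q: "0 < ?q" by simp
  consider "\<bar>x \<bullet> b\<bar> < ?c / 2" | "?c / 2 \<le> x \<bullet> b" | "?c / 2 \<le> - (x \<bullet> b)"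
    by linarith
  \<comment> \<open>The near point has weight at most \<open>1/2\<close> and value at most
    \<open>2 * ?q\<close>, the other two have values at most \<open>?q\<close>. The worst case is
    \<open>1/2 * 2 + 1/2 = 3/2\<close>, which is \<open>2 * (3/4)\<close>.\<close>
  then have "?w x / 2 + (?w (x + ?c *\<^sub>R b) + ?w (x + - ?c *\<^sub>R b)) / 4 \<le> 3 / 2 * ?q"
  proof cases
    case 1
    have "?w (x + ?c *\<^sub>R b) \<le> ?q" "?w (x + - ?c *\<^sub>R b) \<le> ?q"
      by (rule far; use 1 in \<open>simp only: dot; arith\<close>)+
    with Suc[of x] q show ?thesis by argo
  next
    case 2
    have "?w (x + ?c *\<^sub>R b) \<le> ?q" "?w x \<le> ?q"
      by (rule far; use 2 nonneg[of k] in \<open>simp only: dot; arith\<close>)+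
    with Suc[of "x + - ?c *\<^sub>R b"] q show ?thesis by argo
  next
    case 3
    have "?w (x + - ?c *\<^sub>R b) \<le> ?q" "?w x \<le> ?q"
      by (rule far; use 3 nonneg[of k] in \<open>simp only: dot; arith\<close>)+
    with Suc[of "x + ?c *\<^sub>R b"] q show ?thesis by argo
  qed
  then show ?case by simp
qed

text \<open>If \<open>\<theta>\<close> is the deviation of
  \<open>\<omega> j * (x \<bullet> b)\<close> from the integer, the factor number \<open>j\<close>
  equals \<open>1 - (sin (pi * \<theta>))^2\<close>. These factors approach \<open>1\<close> fast
  enough to keep all products above \<open>1/2\<close>.\<close>

lemma riesz_ge_half:
  assumes "\<And>j. \<exists>n::int. \<bar>\<omega> j * (x \<bullet> b) - of_int n\<bar> \<le> (1 / 4) ^ j / 8"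
  shows "1 / 2 \<le> riesz b \<omega> k x"
proof -
  have factor: "1 - (1 / 16) ^ j / 4 \<le> (1 + cos (2 * pi * \<omega> j * (x \<bullet> b))) / 2" for j
  proof -
    obtain n :: int where n: "\<bar>\<omega> j * (x \<bullet> b) - of_int n\<bar> \<le> (1 / 4) ^ j / 8"
      using assms by blast
    define \<theta> where "\<theta> = \<omega> j * (x \<bullet> b) - of_int n"
    have "cos (2 * pi * \<omega> j * (x \<bullet> b)) = cos (2 * pi * \<theta> + 2 * pi * of_int n)"
      by (simp add: \<theta>_def algebra_simps)
    also have "\<dots> = cos (2 * (pi * \<theta>))"
      unfolding cos_add cos_int_2pin sin_int_2pin by (simp add: mult.assoc)
    also have "\<dots> = 1 - 2 * (sin (pi * \<theta>))\<^sup>2"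
      by (rule cos_double_sin)
    finally have c: "(1 + cos (2 * pi * \<omega> j * (x \<bullet> b))) / 2 = 1 - (sin (pi * \<theta>))\<^sup>2"
      by simp
    have "\<bar>sin (pi * \<theta>)\<bar> \<le> pi * \<bar>\<theta>\<bar>"
      using abs_sin_x_le_abs_x[of "pi * \<theta>"] by (simp add: abs_mult)
    also have "\<dots> \<le> 4 * ((1 / 4) ^ j / 8)"
      using n pi_less_4 by (intro mult_mono) (auto simp: \<theta>_def)
    finally have "\<bar>sin (pi * \<theta>)\<bar>\<^sup>2 \<le> ((1 / 4) ^ j / 2)\<^sup>2"
      by (intro power_mono) auto
    also have "\<dots> = ((1 / 4) ^ j * (1 / 4) ^ j) / 4"
      by (simp add: power2_eq_square)
    also have "\<dots> = (1 / 16) ^ j / 4"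
      by (simp flip: power_mult_distrib)
    finally show ?thesis
      unfolding c by simp
  qed
  \<comment> \<open>The bound \<open>1/2\<close> alone is not inductive. The extra term fits the
    empty product at \<open>k = 0\<close>, and its decrease by \<open>15/32 * (1/16)^k\<close> pays
    for the loss of at most \<open>(1/16)^k / 4\<close> caused by the new factor.\<close>
  have "1 / 2 + (1 / 16) ^ k / 2 \<le> riesz b \<omega> k x"
  proof (induction k)
    case 0
    then show ?case by (simp add: riesz_def)
  next
    case (Suc k)
    let ?q = "(1 / 16) ^ k :: real"
    have q: "0 \<le> ?q" "?q \<le> 1" by (auto simp: power_le_one)
    have "0 \<le> ?q * (1 - ?q)"
      using q by (intro mult_nonneg_nonneg) auto
    moreover have "(1 / 2 + ?q / 2) * (1 - ?q / 4) = 1 / 2 + ?q / 4 + ?q * (1 - ?q) / 8"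
      by (simp add: field_simps)
    moreover have "(1 / 16) ^ Suc k / 2 = ?q / 32" by simp
    ultimately have "1 / 2 + (1 / 16) ^ Suc k / 2 \<le> (1 / 2 + ?q / 2) * (1 - ?q / 4)"
      using q by linarith
    also have "\<dots> \<le> riesz b \<omega> k x * ((1 + cos (2 * pi * \<omega> k * (x \<bullet> b))) / 2)"
      using q by (intro mult_mono Suc factor riesz_nonneg) auto
    finally show ?case by (simp add: riesz_def)
  qed
  then show ?thesis
    by (smt (verit) zero_le_power divide_nonneg_nonneg)
qed

subsection \<open>The frequencies\<close>

text \<open>Inserting \<open>2 j - 1\<close> zeros in front of the binary digit number \<open>2 ^ j\<close>, for every \<open>j > 0\<close>, moves
  the digit number \<open>i\<close> to the position \<open>slot i\<close>.\<close>

definition slot :: "nat \<Rightarrow> nat" where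
  "slot i = i + (floor_log i)\<^sup>2"

text \<open>The exponent is the last position before a block of \<open>2 k + 3\<close> inserted
  zeros. After scaling by \<open>freq k\<close> the fractional part begins with this block, so it is
  at most \<open>(1/2)^(2 k + 3) = (1/4)^k / 8\<close>, as \<open>riesz_ge_half\<close>
  demands.\<close>

definition freq :: "nat \<Rightarrow> real" where
  "freq k = 2 ^ slot (2 ^ (k + 2) - 1)"

lemma slot_less: "slot i < slot (Suc i)"
  using floor_log_le_iff[of i "Suc i"] by (simp add: slot_def le_imp_less_Suc power_mono)

lemma slot_mono: "i \<le> j \<Longrightarrow> slot i \<le> slot j"
  using slot_less lift_Suc_mono_le[of slot] less_imp_le by blast

lemma halving_slot: "halving (\<lambda>i. (1 / 2) ^ slot i)"
proof
  fix i
  have "(1 / 2) ^ slot (Suc i) \<le> (1 / 2 :: real) ^ Suc (slot i)"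
    using slot_less[of i] by (intro power_decreasing) auto
  then show "2 * (1 / 2) ^ slot (Suc i) \<le> (1 / 2 :: real) ^ slot i"
    by simp
qed simp

lemma floor_log_pow2_minus_1: "floor_log (2 ^ Suc j - 1) = j"
proof (rule floor_log_eqI)
  have "0 < (2::nat) ^ j" by simp
  then show "0 < 2 ^ Suc j - (1::nat)" "2 ^ j \<le> 2 ^ Suc j - (1::nat)" "2 ^ Suc j - 1 < 2 * (2::nat) ^ j"
    unfolding power_Suc by linarith+
qed

lemma slot_pow2: "slot (2 ^ Suc j) = slot (2 ^ Suc j - 1) + 2 * Suc j"
  unfolding slot_def floor_log_pow2_minus_1 floor_log_power by (simp add: power2_eq_square)

lemma freq_Suc: "4 * freq k \<le> freq (Suc k)"
proof -
  have "slot (2 ^ (k + 2) - 1) + 2 \<le> slot (2 ^ (k + 2))"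
    using slot_pow2[of "Suc k"] by simp
  also have "\<dots> \<le> slot (2 ^ (Suc k + 2) - 1)"
    by (intro slot_mono) (use one_le_power[of "2::nat" "k+2"] in simp)
  finally have "(2::real) ^ (slot (2 ^ (k + 2) - 1) + 2) \<le> freq (Suc k)"
    unfolding freq_def by (intro power_increasing) auto
  then show ?thesis
    by (simp add: freq_def power_add)
qed

text \<open>Growth by the factor \<open>4\<close> gives the two bounds
  \<open>3 * (\<Sum>j<k. freq j) \<le> freq k\<close> and \<open>6 * real k \<le> freq k\<close>.
  They are combined with weights \<open>2/3\<close> and \<open>1/3\<close>.\<close>

lemma freq_lacunary: "2 * (\<Sum>j<k. freq j) + 2 * real k \<le> freq k"
proof -
  have "3 * (\<Sum>j<k. freq j) \<le> freq k"
  proof (induction k)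
    case 0
    then show ?case by (simp add: freq_def)
  next
    case (Suc k)
    then show ?case using freq_Suc[of k] by simp
  qed
  moreover have "6 * real k \<le> freq k"
  proof (induction k)
    case 0
    then show ?case by (simp add: freq_def)
  next
    case (Suc k)
    have "2 ^ 1 \<le> (2 :: real) ^ slot (2 ^ (k + 2) - 1)"
    proof (intro power_increasing)
      have "1 \<le> 2 ^ (k + 2) - (1 :: nat)"
        using less_exp[of "k + 2"] by linarith
      then show "1 \<le> slot (2 ^ (k + 2) - 1)"
        unfolding slot_def by (rule trans_le_add1)
    qed simp
    with Suc show ?case using freq_Suc[of k] by (simp add: freq_def)
  qed
  ultimately show ?thesis by simp
qed

lemma freq_near_integer:
  "\<exists>n::int. \<bar>freq k * spread (\<lambda>i. (1 / 2) ^ slot i) t - of_int n\<bar> \<le> (1 / 4) ^ k / 8"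
proof -
  interpret halving "\<lambda>i. (1 / 2) ^ slot i" by (rule halving_slot)
  let ?i = "2 ^ (k + 2) - 1 :: nat"
  have "freq k * (1 / 2) ^ slot (Suc l) \<in> \<int>" if "l < ?i" for l
  proof -
    have "slot (Suc l) \<le> slot ?i"
      using that by (intro slot_mono) simp
    then have "freq k = 2 ^ (slot ?i - slot (Suc l)) * 2 ^ slot (Suc l)"
      unfolding freq_def power_add[symmetric] by simp
    then have "freq k * (1 / 2) ^ slot (Suc l) = 2 ^ (slot ?i - slot (Suc l))"
      by (simp add: power_one_over)
    then show ?thesis by (simp only: Ints_power Ints_numeral)
  qed
  moreover have "0 \<le> freq k" by (simp add: freq_def)
  ultimately obtain n where n: "\<bar>freq k * spread (\<lambda>i. (1 / 2) ^ slot i) t - of_int n\<bar> \<le> 2 * (freq k * (1 / 2) ^ slot (Suc ?i))"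
    using spread_near_integer[of ?i "freq k" t] by metis
  have "Suc ?i = 2 ^ Suc (Suc k)" by simp
  then have "slot (Suc ?i) = slot ?i + 2 * Suc (Suc k)"
    using slot_pow2[of "Suc k"] by simp
  then have "2 * (freq k * (1 / 2) ^ slot (Suc ?i)) = 2 * (1 / 2) ^ (2 * Suc (Suc k))"
    by (simp add: freq_def power_add power_one_over)
  also have "\<dots> = (1 / 4) ^ k / 8"
    by (simp add: power_mult power2_eq_square)
  finally show ?thesis using n by metis
qed

text \<open>In logarithms to base \<open>2\<close> the claim reads
  \<open>s * slot i \<le> i + N^2\<close>, with \<open>C = 2^(N^2)\<close>. It holds because the
  number of inserted zeros is only the square of a logarithm of \<open>i\<close>.\<close>

lemma slot_sublinear:
  fixes s :: real
  assumes s: "0 < s" "s < 1"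
  shows "\<exists>C>0. \<forall>i. (1 / 2) ^ i \<le> C * ((1 / 2) ^ slot i) powr s"
proof -
  \<comment> \<open>The square of this sequence is \<open>L^2 / 2^L\<close>.\<close>
  have "(\<lambda>L. real L * (1 / sqrt 2) ^ L) \<longlonglongrightarrow> 0"
    by (intro powser_times_n_limit_0) simp
  from tendsto_power[OF this, of 2] have "(\<lambda>L. (real L * (1 / sqrt 2) ^ L)\<^sup>2) \<longlonglongrightarrow> 0"
    by simp
  from order_tendstoD(2)[OF this, of "1 - s"]
  have "\<forall>\<^sub>F L in sequentially. (real L * (1 / sqrt 2) ^ L)\<^sup>2 < 1 - s"
    using s by simp
  then obtain N where N: "\<And>L. N \<le> L \<Longrightarrow> (real L * (1 / sqrt 2) ^ L)\<^sup>2 < 1 - s"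
    by (auto simp: eventually_sequentially)
  \<comment> \<open>From \<open>N\<close> on the exponential term dominates, and before
    \<open>N\<close> the constant does.\<close>
  have *: "s * (real L)\<^sup>2 \<le> (1 - s) * 2 ^ L + (real N)\<^sup>2" for L
  proof (cases "N \<le> L")
    case True
    have "(sqrt 2 ^ L)\<^sup>2 = (sqrt 2 ^ 2) ^ L"
      by (simp only: power_mult[symmetric] mult.commute)
    also have "\<dots> = 2 ^ L" by simp
    finally have "(real L * (1 / sqrt 2) ^ L)\<^sup>2 = (real L)\<^sup>2 / 2 ^ L"
      by (simp add: power_mult_distrib power_divide)
    with N[OF True] have "(real L)\<^sup>2 / 2 ^ L < 1 - s"
      by simp
    then have "(real L)\<^sup>2 \<le> (1 - s) * 2 ^ L"
      by (simp add: pos_divide_less_eq)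
    moreover have "s * (real L)\<^sup>2 \<le> 1 * (real L)\<^sup>2"
      using s by (intro mult_right_mono) auto
    ultimately show ?thesis by (smt (verit) zero_le_power2)
  next
    case False
    have "s * (real L)\<^sup>2 \<le> 1 * (real N)\<^sup>2"
      using s False by (intro mult_mono power_mono) auto
    then show ?thesis using s by (simp add: add_increasing)
  qed
  show ?thesis
  proof (intro exI conjI allI)
    show "0 < (2::real) powr ((real N)\<^sup>2)" by simp
    fix i
    have "s * real (slot i) \<le> real i + (real N)\<^sup>2"
    proof (cases "i = 0")
      case False
      then have "2 ^ floor_log i \<le> i"
        by (intro floor_log_exp2_le) simp
      then have "(2::real) ^ floor_log i \<le> real i"
        by (metis of_nat_le_iff of_nat_numeral of_nat_power)
      then have "(1 - s) * 2 ^ floor_log i \<le> (1 - s) * real i"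
        using s by (intro mult_left_mono) auto
      with *[of "floor_log i"] show ?thesis
        by (simp add: slot_def algebra_simps)
    qed (simp add: slot_def)
    then have "2 powr (- real i) \<le> 2 powr ((real N)\<^sup>2 - s * real (slot i))"
      by (intro powr_mono) auto
    also have "\<dots> = 2 powr ((real N)\<^sup>2) * ((1 / 2) ^ slot i) powr s"
      by (simp add: powr_diff powr_powr powr_minus_divide power_one_over powr_divide mult.commute flip: powr_realpow)
    finally show "(1 / 2) ^ i \<le> 2 powr ((real N)\<^sup>2) * ((1 / 2) ^ slot i) powr s"
      by (simp add: powr_minus_divide power_one_over powr_realpow)
  qed
qed

subsection \<open>The counterexample\<close>

lemma lborel_distr_reflect: "distr lborel borel (\<lambda>y. x - y) = (lborel :: 'a::euclidean_space measure)"
  using lborel_affine[of "-1" x] by (simp add: density_1)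

text \<open>Near \<open>x\<close> the modulus of \<open>g\<close> is at least
  \<open>norm c + 1\<close> almost everywhere, hence \<open>g\<close> stays at distance at least
  \<open>1\<close> from \<open>c\<close>, and the averages are bounded below by the volume of the
  unit ball.\<close>

lemma not_lebesgue_point:
  fixes g :: "'a::euclidean_space \<Rightarrow> complex"
  assumes g [measurable]: "g \<in> borel_measurable borel"
    and large: "\<And>M. \<exists>r>0. AE z in lborel. z \<in> ball x r \<longrightarrow> M \<le> norm (g z)"
  shows "\<not> lebesgue_point g x"
proof
  assume "lebesgue_point g x"
  then obtain c where c: "((\<lambda>r. (\<integral>\<^sup>+y\<in>ball 0 r. ennreal (norm (g (x - y) - c)) \<partial>lborel) / ennreal (r ^ DIM('a)))
        \<longlongrightarrow> 0) (at_right 0)"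
    by (auto simp: lebesgue_point_def)
  obtain r where r: "0 < r" "AE z in lborel. z \<in> ball x r \<longrightarrow> norm c + 1 \<le> norm (g z)"
    using large by blast
  \<comment> \<open>The averages involve \<open>g (x - y)\<close>. The reflection
    \<open>y \<mapsto> x - y\<close> preserves Lebesgue measure and carries the bound over to the
    variable \<open>y\<close>.\<close>
  have "AE z in distr lborel borel (\<lambda>y. x - y). z \<in> ball x r \<longrightarrow> norm c + 1 \<le> norm (g z)"
    unfolding lborel_distr_reflect by (rule r(2))
  then have ae: "AE y in lborel. x - y \<in> ball x r \<longrightarrow> norm c + 1 \<le> norm (g (x - y))"
    by (subst (asm) AE_distr_iff) (auto simp: dist_norm)
  have "ennreal (unit_ball_vol (real DIM('a)))
      \<le> (\<integral>\<^sup>+y\<in>ball 0 \<rho>. ennreal (norm (g (x - y) - c)) \<partial>lborel) / ennreal (\<rho> ^ DIM('a))"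
    if \<rho>: "0 < \<rho>" "\<rho> < r" for \<rho>
  proof -
    have "ennreal (unit_ball_vol (real DIM('a))) * ennreal (\<rho> ^ DIM('a)) = emeasure lborel (ball 0 \<rho> :: 'a set)"
      using \<rho> by (simp add: emeasure_ball ennreal_mult)
    also have "\<dots> = (\<integral>\<^sup>+y. indicator (ball 0 \<rho> :: 'a set) y \<partial>lborel)"
      by simp
    also have "\<dots> \<le> (\<integral>\<^sup>+y\<in>ball 0 \<rho>. ennreal (norm (g (x - y) - c)) \<partial>lborel)"
    proof (intro nn_integral_mono_AE AE_mp[OF ae AE_I2] impI)
      fix y assume y: "x - y \<in> ball x r \<longrightarrow> norm c + 1 \<le> norm (g (x - y))"
      show "indicator (ball 0 \<rho>) y \<le> ennreal (norm (g (x - y) - c)) * indicator (ball 0 \<rho>) y"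
      proof (cases "y \<in> ball 0 \<rho>")
        case True
        then have "norm c + 1 \<le> norm (g (x - y))"
          using y \<rho> by (auto simp: dist_norm)
        with norm_triangle_ineq2[of "g (x - y)" c] have "1 \<le> norm (g (x - y) - c)"
          by linarith
        then have "1 \<le> ennreal (norm (g (x - y) - c))"
          by (subst ennreal_1[symmetric]) (rule ennreal_leI)
        with True show ?thesis
          by simp
      qed simp
    qed
    finally have "ennreal (unit_ball_vol (real DIM('a))) * ennreal (\<rho> ^ DIM('a)) / ennreal (\<rho> ^ DIM('a))
        \<le> (\<integral>\<^sup>+y\<in>ball 0 \<rho>. ennreal (norm (g (x - y) - c)) \<partial>lborel) / ennreal (\<rho> ^ DIM('a))"
      by (rule divide_right_mono_ennreal)
    then show ?thesis
      using \<rho> by (subst (asm) ennreal_mult_divide_eq) auto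
  qed
  then have "\<forall>\<^sub>F \<rho> in at_right 0. ennreal (unit_ball_vol (real DIM('a)))
      \<le> (\<integral>\<^sup>+y\<in>ball 0 \<rho>. ennreal (norm (g (x - y) - c)) \<partial>lborel) / ennreal (\<rho> ^ DIM('a))"
    using r(1) by (auto simp: eventually_at_right_field intro!: exI[of _ r])
  from tendsto_lowerbound[OF c this] show False
    using unit_ball_vol_pos[of "real DIM('a)"] by simp
qed

text \<open>For finite \<open>p\<close> the \<open>p\<close>-th power of a wave is at most its
  supremum to the power \<open>p - 1\<close> times the wave, which has integral \<open>1\<close>.
  This decays geometrically because \<open>p > 1\<close>. For \<open>p = \<infinity>\<close> the
  geometric series bounds the sum by \<open>8\<close>.\<close>

lemma Lp_suminf_wave:
  assumes b: "b \<in> Basis" and p: "1 < p"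
  shows "(\<lambda>x. complex_of_real (\<Sum>k. wave b freq k x)) \<in> Lp p"
proof -
  note w = wave_le_geometric[OF b freq_lacunary]
  have geo: "(\<lambda>k. 2 * (3 / 4) ^ k) sums (8::real)"
    using sums_mult[OF geometric_sums[of "3 / 4 :: real"], of 2] by simp
  have summ: "summable (\<lambda>k. wave b freq k x)" for x
    by (rule summable_comparison_test'[OF sums_summable[OF geo], of 0]) (simp add: wave_nonneg w)
  have nn: "0 \<le> (\<Sum>k. wave b freq k x)" for x
    by (intro suminf_nonneg summ wave_nonneg)
  show ?thesis
  proof (cases "p = \<infinity>")
    case True
    have "(\<Sum>k. wave b freq k x) \<le> 8" for x
      using suminf_le[OF w summ sums_summable[OF geo], of x] sums_unique[OF geo] by simp
    with True nn show ?thesis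
      by (auto simp: Lp_def intro!: exI[of _ 8])
  next
    case False
    define r where "r = enn2real p"
    have r: "1 < r"
      using p False unfolding r_def by (cases p) auto
    define q :: real where "q = (3 / 4) powr (r - 1)"
    have q: "0 < q" "q < 1"
      using r powr_less_mono2[of "r - 1" "3 / 4" 1] by (auto simp: q_def)
    have "(\<integral>\<^sup>+x. ennreal (wave b freq k x powr r) \<partial>lborel) \<le> ennreal (2 powr (r - 1) * q ^ k)" for k
    proof -
      have pw: "(2 * (3 / 4) ^ k) powr (r - 1) = 2 powr (r - 1) * q ^ k"
        by (simp add: powr_mult q_def powr_powr mult.commute flip: powr_realpow)
      have "wave b freq k x powr r \<le> 2 powr (r - 1) * q ^ k * wave b freq k x" for x
      proof -
        have "wave b freq k x powr r = wave b freq k x powr (r - 1) * wave b freq k x"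
          using wave_nonneg[of b freq k x] powr_add[of "wave b freq k x" "r - 1" 1] by simp
        also have "\<dots> \<le> (2 * (3 / 4) ^ k) powr (r - 1) * wave b freq k x"
          using r by (intro mult_right_mono powr_mono2 wave_nonneg w) auto
        finally show ?thesis unfolding pw .
      qed
      then have "(\<integral>\<^sup>+x. ennreal (wave b freq k x powr r) \<partial>lborel)
          \<le> (\<integral>\<^sup>+x. ennreal (2 powr (r - 1) * q ^ k) * ennreal (wave b freq k x) \<partial>lborel)"
        using q by (intro nn_integral_mono) (simp add: wave_nonneg ennreal_leI flip: ennreal_mult)
      also have "\<dots> = ennreal (2 powr (r - 1) * q ^ k)"
        by (subst nn_integral_cmult) (auto simp: nn_integral_wave)
      finally show ?thesis .
    qed
    from geometric_Lp_sum(2)[of r q "2 powr (r - 1)" "wave b freq", OF _ q _ _ wave_nonneg this]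
    have "(\<integral>\<^sup>+x. ennreal ((\<Sum>k. wave b freq k x) powr r) \<partial>lborel) < \<infinity>"
      using r by (auto elim!: le_less_trans)
    with False nn show ?thesis
      by (simp add: Lp_def flip: r_def)
  qed
qed

context
  fixes b :: "'a::euclidean_space"
  assumes b: "b \<in> Basis"
begin

text \<open>As \<open>spec\<close> has values in \<open>[0, 1]\<close>, its square is at most
  \<open>spec\<close> itself, whose integral is the value of \<open>wave\<close> at the
  origin.\<close>

lemma nn_integral_spec_square: "(\<integral>\<^sup>+x. ennreal (spec b freq k x powr 2) \<partial>lborel) \<le> ennreal (2 * (3 / 4) ^ k)"
proof -
  have "spec b freq k x powr 2 \<le> spec b freq k x" for x
    using mult_left_mono[OF spec_le_1[of b freq k x] spec_nonneg[of b freq k x]]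
    by (simp add: powr_numeral spec_nonneg power2_eq_square)
  then have "(\<integral>\<^sup>+x. ennreal (spec b freq k x powr 2) \<partial>lborel) \<le> (\<integral>\<^sup>+x. ennreal (spec b freq k x) \<partial>lborel)"
    by (intro nn_integral_mono ennreal_leI)
  also have "\<dots> \<le> ennreal (2 * (3 / 4) ^ k)"
    unfolding nn_integral_spec by (intro ennreal_leI wave_le_geometric b freq_lacunary)
  finally show ?thesis .
qed

lemma AE_summable_spec: "AE x in lborel. summable (\<lambda>k. spec b freq k x)"
  by (rule geometric_Lp_sum(1)[where p=2 and q="3 / 4" and C=2])
    (auto simp: spec_nonneg nn_integral_spec_square simp del: powr_numeral)

text \<open>The second series diverges on the null set \<open>bad_set\<close> below, where the value of \<^const>\<open>suminf\<close> is junk.\<close>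

lemma has_fourier_L2_suminf_wave:
  "has_fourier_L2 (\<lambda>x. of_real (\<Sum>k. wave b freq k x)) (\<lambda>x. of_real (\<Sum>k. spec b freq k x))"
proof -
  \<comment> \<open>Partial sums serve as the approximating sequence. The full sum is not in
    \<open>Lp 1\<close>, every wave having integral \<open>1\<close>.\<close>
  let ?h = "\<lambda>n x. complex_of_real (\<Sum>k<n. wave b freq k x)"
  have wave_square: "(\<integral>\<^sup>+x. ennreal (wave b freq k x powr 2) \<partial>lborel) \<le> ennreal (2 * (3 / 4) ^ k)" for k
  proof -
    have "(\<integral>\<^sup>+x. ennreal (wave b freq k x powr 2) \<partial>lborel)
        \<le> (\<integral>\<^sup>+x. ennreal (2 * (3 / 4) ^ k) * ennreal (wave b freq k x) \<partial>lborel)"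
      using mult_right_mono[OF wave_le_geometric[OF b freq_lacunary, of k] wave_nonneg]
      by (intro nn_integral_mono)
        (simp add: powr_numeral wave_nonneg power2_eq_square ennreal_leI flip: ennreal_mult)
    also have "\<dots> = ennreal (2 * (3 / 4) ^ k)"
      by (subst nn_integral_cmult) (auto simp: nn_integral_wave)
    finally show ?thesis .
  qed
  have g2: "(\<lambda>x. complex_of_real (\<Sum>k. spec b freq k x)) \<in> Lp 2"
  proof -
    have "(\<integral>\<^sup>+x. ennreal ((\<Sum>k. spec b freq k x) powr 2) \<partial>lborel) < \<infinity>"
      by (rule le_less_trans[OF geometric_Lp_sum(2)[where p=2 and q="3 / 4" and C=2]])
        (auto simp: spec_nonneg nn_integral_spec_square simp del: powr_numeral)
    moreover have "(\<integral>\<^sup>+x. ennreal (norm (complex_of_real (\<Sum>k. spec b freq k x)) powr 2) \<partial>lborel)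
        = (\<integral>\<^sup>+x. ennreal ((\<Sum>k. spec b freq k x) powr 2) \<partial>lborel)"
      by (intro nn_integral_cong_AE eventually_mono[OF AE_summable_spec])
        (simp only: norm_of_real abs_of_nonneg suminf_nonneg spec_nonneg)
    ultimately show ?thesis
      by (simp add: Lp_def del: powr_numeral norm_of_real)
  qed
  have h: "?h n \<in> Lp 1 \<inter> Lp 2" for n
  proof
    have nn: "0 \<le> (\<Sum>k<n. wave b freq k x)" for x
      by (intro sum_nonneg wave_nonneg)
    have "(\<integral>\<^sup>+x. ennreal (\<Sum>k<n. wave b freq k x) \<partial>lborel) = (\<Sum>k<n. \<integral>\<^sup>+x. ennreal (wave b freq k x) \<partial>lborel)"
      by (subst nn_integral_sum[symmetric]) (auto simp: wave_nonneg)
    also have "\<dots> < \<infinity>"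
      by (simp add: nn_integral_wave of_nat_less_top)
    finally have fin: "(\<integral>\<^sup>+x. ennreal (\<Sum>k<n. wave b freq k x) \<partial>lborel) < \<infinity>" .
    then show "?h n \<in> Lp 1"
      by (simp add: Lp_def nn del: of_real_sum)
    have le: "(\<Sum>k<n. wave b freq k x) \<le> real n * 2" for x
    proof -
      have "wave b freq k x \<le> 2" for k
        using wave_le_geometric[OF b freq_lacunary, of k x] power_le_one[of "3 / 4 :: real" k] by simp
      then show ?thesis
        using sum_bounded_above[of "{..<n}" "\<lambda>k. wave b freq k x" 2] by simp
    qed
    have "(\<integral>\<^sup>+x. ennreal ((\<Sum>k<n. wave b freq k x) powr 2) \<partial>lborel)
        \<le> (\<integral>\<^sup>+x. ennreal (real n * 2) * ennreal (\<Sum>k<n. wave b freq k x) \<partial>lborel)"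
      using mult_right_mono[OF le nn]
      by (intro nn_integral_mono)
        (simp add: powr_numeral nn power2_eq_square ennreal_leI flip: ennreal_mult)
    also have "\<dots> < \<infinity>"
      using fin
      by (subst nn_integral_cmult) (auto simp: ennreal_mult_less_top)
    finally show "?h n \<in> Lp 2"
      by (simp add: Lp_def nn del: of_real_sum)
  qed
  have "fourier_L1 (?h n) \<xi> = of_real (\<Sum>k<n. spec b freq k \<xi>)" for n \<xi>
  proof -
    have "fourier_L1 (?h n) \<xi> = (\<Sum>k<n. fourier_L1 (\<lambda>x. of_real (wave b freq k x)) \<xi>)"
      unfolding fourier_L1_def of_real_sum sum_distrib_left
      by (intro Bochner_Integration.integral_sum integrable_cis_wave)
    then show ?thesis
      by (simp add: fourier_L1_wave)
  qed
  then have "(\<lambda>n. fourier_L1 (?h n)) = (\<lambda>n \<xi>. of_real (\<Sum>k<n. spec b freq k \<xi>))"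
    by (simp add: fun_eq_iff)
  moreover have "tendsto_L2 (\<lambda>n \<xi>. of_real (\<Sum>k<n. spec b freq k \<xi>)) (\<lambda>x. of_real (\<Sum>k. spec b freq k x))"
    by (rule tendsto_L2_suminf[where q="3 / 4" and C=2]) (auto simp: spec_nonneg nn_integral_spec_square simp del: powr_numeral)
  moreover have "tendsto_L2 ?h (\<lambda>x. of_real (\<Sum>k. wave b freq k x))"
    by (rule tendsto_L2_suminf[where q="3 / 4" and C=2]) (auto simp: wave_nonneg wave_square simp del: powr_numeral)
  moreover have "(\<lambda>x. complex_of_real (\<Sum>k. wave b freq k x)) \<in> Lp 2"
    by (rule Lp_suminf_wave[OF b]) simp
  ultimately show ?thesis
    unfolding has_fourier_L2_def using g2 h by (auto intro!: exI[of _ ?h] simp del: of_real_sum)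
qed

definition bad_set :: "'a set" where
  "bad_set = {x \<in> cbox 0 One. \<forall>k. 1 / 2 \<le> riesz b freq k x}"

lemma compact_bad_set: "compact bad_set"
proof -
  have "bad_set = cbox 0 One \<inter> (\<Inter>k. {x. 1 / 2 \<le> riesz b freq k x})"
    by (auto simp: bad_set_def)
  moreover have "closed {x. 1 / 2 \<le> riesz b freq k x}" for k
    by (intro closed_Collect_le continuous_intros)
  ultimately show ?thesis
    by (auto intro!: compact_Int_closed closed_INT)
qed

text \<open>All terms are at least \<open>gauss x / 2\<close> at \<open>x\<close>, so some partial
  sum exceeds \<open>M\<close> there and, by continuity, in a ball around \<open>x\<close>. The
  other terms are nonnegative, so the full sum exceeds \<open>M\<close> wherever it converges in
  that ball.\<close>

lemma not_lebesgue_point_bad_set: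
  assumes x: "x \<in> bad_set"
  shows "\<not> lebesgue_point (\<lambda>x. of_real (\<Sum>k. spec b freq k x)) x"
proof (rule not_lebesgue_point)
  fix M :: real
  have "gauss x / 2 \<le> spec b freq k x" for k
    using x mult_right_mono[of "1 / 2" "riesz b freq k x" "gauss x"] gauss_pos[of x]
    by (auto simp: bad_set_def spec_def)
  then have K: "real K * (gauss x / 2) \<le> (\<Sum>k<K. spec b freq k x)" for K
    using sum_bounded_below[of "{..<K}" "gauss x / 2" "\<lambda>k. spec b freq k x"] by simp
  obtain K where "M < real K * (gauss x / 2)"
    using ex_less_of_nat_mult[of "gauss x / 2" M] gauss_pos[of x] by auto
  then have M: "M < (\<Sum>k<K. spec b freq k x)"
    by (rule less_le_trans[OF _ K])
  have "open {y. M < (\<Sum>k<K. spec b freq k y)}"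
    by (intro open_Collect_less continuous_intros)
  then obtain r where r: "0 < r" "ball x r \<subseteq> {y. M < (\<Sum>k<K. spec b freq k y)}"
    using M by (auto simp: open_contains_ball)
  have "M \<le> norm (complex_of_real (\<Sum>k. spec b freq k z))"
    if "z \<in> ball x r" "summable (\<lambda>k. spec b freq k z)" for z
  proof -
    have "M < (\<Sum>k<K. spec b freq k z)"
      using r that by auto
    also have "\<dots> \<le> (\<Sum>k. spec b freq k z)"
      using that by (intro sum_le_suminf) (auto simp: spec_nonneg)
    finally show ?thesis by simp
  qed
  then show "\<exists>r>0. AE z in lborel. z \<in> ball x r \<longrightarrow> M \<le> norm (complex_of_real (\<Sum>k. spec b freq k z))"
    using r(1) AE_summable_spec by (intro exI[of _ r]) (auto elim!: eventually_mono)
qed measurable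

lemma hausdorff_dimension_bad_set: "hausdorff_dimension bad_set = of_nat DIM('a)"
proof -
  interpret halving "\<lambda>i. (1 / 2) ^ slot i" by (rule halving_slot)
  define \<Phi> where "\<Phi> = spread (\<lambda>i. (1 / 2) ^ slot i)"
  \<comment> \<open>Zeros are inserted only into the coordinate along \<open>b\<close>; the other
    coordinates stay as they are.\<close>
  define \<Psi> where "\<Psi> t = t + (\<Phi> (t \<bullet> b) - t \<bullet> b) *\<^sub>R b" for t
  have \<Psi>_inner: "\<Psi> t \<bullet> i = (if i = b then \<Phi> (t \<bullet> b) else t \<bullet> i)" if "i \<in> Basis" for t i
    using that b by (auto simp: \<Psi>_def inner_add_left inner_Basis)
  have \<Phi>_bounds: "0 \<le> \<Phi> t" "\<Phi> t \<le> 1" for t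
    using spread_bounds[of t] by (auto simp: \<Phi>_def slot_def)
  have sub: "\<Psi> ` box 0 One \<subseteq> bad_set"
  proof clarify
    fix t :: 'a assume t: "t \<in> box 0 One"
    have "\<Psi> t \<in> cbox 0 One"
      using t \<Phi>_bounds by (auto simp: mem_box \<Psi>_inner less_imp_le)
    moreover have "1 / 2 \<le> riesz b freq k (\<Psi> t)" for k
      using freq_near_integer by (intro riesz_ge_half) (simp add: \<Psi>_inner b \<Phi>_def)
    ultimately show "\<Psi> t \<in> bad_set"
      by (simp add: bad_set_def)
  qed
  show ?thesis
  proof (rule hausdorff_dimension_eq_DIM[OF compact_imp_bounded[OF compact_bad_set] _ _ sub])
    show "0 < emeasure lborel (box 0 One :: 'a set)"
      by (subst emeasure_lborel_box) auto
    fix s :: real assume s: "0 < s" "s < 1"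
    obtain C where C: "0 < C" "\<And>i. (1 / 2) ^ i \<le> C * ((1 / 2) ^ slot i) powr s"
      using slot_sublinear[OF s] by blast
    \<comment> \<open>The points \<open>t\<close> and \<open>t'\<close> differ by at most
      \<open>2 * norm \<Delta>\<close> plus the difference of their coordinates along
      \<open>b\<close>. The two summands of \<open>D\<close> come from \<open>lin\<close> and
      \<open>main\<close> below.\<close>
    define D where "D = 2 * real DIM('a) + 4 * C"
    have "dist t t' \<le> D * dist (\<Psi> t) (\<Psi> t') powr s" if t: "t \<in> box 0 One" "t' \<in> box 0 One" for t t'
    proof -
      define \<Delta> where "\<Delta> = \<Psi> t - \<Psi> t'"
      have in_cbox: "\<Psi> t \<in> cbox 0 One" "\<Psi> t' \<in> cbox 0 One"
        using sub t by (auto simp: bad_set_def)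
      have "\<bar>\<Delta> \<bullet> i\<bar> \<le> 1" if "i \<in> Basis" for i
        using in_cbox that by (force simp: \<Delta>_def mem_box inner_diff_left abs_le_iff)
      then have "norm \<Delta> \<le> real DIM('a)"
        using norm_le_l1[of \<Delta>] sum_bounded_above[of Basis "\<lambda>i. \<bar>\<Delta> \<bullet> i\<bar>" 1] by simp
      \<comment> \<open>Below \<open>1\<close> lowering the exponent to \<open>s\<close> only
        increases the power. Otherwise the power is at least \<open>1\<close>, and
        \<open>norm \<Delta>\<close> is at most the dimension.\<close>
      have lin: "norm \<Delta> \<le> real DIM('a) * norm \<Delta> powr s"
      proof (cases "norm \<Delta> \<le> 1")
        case True
        then have "norm \<Delta> \<le> norm \<Delta> powr s"
          using s powr_mono'[of s 1 "norm \<Delta>"] by simp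
        also have "\<dots> \<le> real DIM('a) * norm \<Delta> powr s"
          using DIM_positive[where 'a='a] mult_right_mono[of 1 "real DIM('a)" "norm \<Delta> powr s"] by simp
        finally show ?thesis .
      next
        case False
        then have "1 \<le> norm \<Delta> powr s"
          using s by (intro ge_one_powr_ge_zero) auto
        then have "real DIM('a) * 1 \<le> real DIM('a) * norm \<Delta> powr s"
          by (intro mult_left_mono) auto
        then show ?thesis using \<open>norm \<Delta> \<le> real DIM('a)\<close> by linarith
      qed
      have dot: "\<Delta> \<bullet> b = \<Phi> (t \<bullet> b) - \<Phi> (t' \<bullet> b)"
        using b by (simp add: \<Delta>_def inner_diff_left \<Psi>_inner)
      have "\<bar>t \<bullet> b - t' \<bullet> b\<bar> \<le> 4 * C * \<bar>\<Delta> \<bullet> b\<bar> powr s"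
        unfolding dot \<Phi>_def using t b by (intro spread_expand s C) (auto simp: mem_box less_imp_le)
      also have "\<dots> \<le> 4 * C * norm \<Delta> powr s"
        using C s Basis_le_norm[OF b, of \<Delta>] by (intro mult_left_mono powr_mono2) auto
      finally have main: "\<bar>t \<bullet> b - t' \<bullet> b\<bar> \<le> 4 * C * norm \<Delta> powr s" .
      have "t - t' = \<Delta> + ((t \<bullet> b - t' \<bullet> b) - \<Delta> \<bullet> b) *\<^sub>R b"
        unfolding dot by (simp add: \<Delta>_def \<Psi>_def algebra_simps)
      then have "norm (t - t') \<le> norm \<Delta> + \<bar>(t \<bullet> b - t' \<bullet> b) - \<Delta> \<bullet> b\<bar>"
        using norm_triangle_ineq[of \<Delta> "((t \<bullet> b - t' \<bullet> b) - \<Delta> \<bullet> b) *\<^sub>R b"] b by simp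
      also have "\<dots> \<le> 2 * norm \<Delta> + \<bar>t \<bullet> b - t' \<bullet> b\<bar>"
        using Basis_le_norm[OF b, of \<Delta>] by linarith
      finally show ?thesis
        using lin main by (simp add: dist_norm D_def \<Delta>_def distrib_right)
    qed
    moreover have "0 < D"
      using C by (simp add: D_def add_nonneg_pos)
    ultimately show "\<exists>C>0. \<forall>t\<in>box 0 One. \<forall>t'\<in>box 0 One. dist t t' \<le> C * dist (\<Psi> t) (\<Psi> t') powr s"
      by blast
  qed simp
qed

end

theorem theorem1:
  shows "\<exists>(f :: real ^ 'n::finite \<Rightarrow> complex) (E :: (real ^ 'n) set).
           f \<in> (\<Inter>p\<in>{1<..}. Lp p) \<and>
           compact E \<and> hausdorff_dimension E = of_nat CARD('n) \<and>
           (\<exists>g. has_fourier_L2 f g \<and> (\<forall>x\<in>E. \<not> lebesgue_point g x))"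
proof -
  obtain b :: "real ^ 'n" where b: "b \<in> Basis"
    using nonempty_Basis by blast
  show ?thesis
  proof (intro exI conjI)
    show "(\<lambda>x. complex_of_real (\<Sum>k. wave b freq k x)) \<in> (\<Inter>p\<in>{1<..}. Lp p)"
      using Lp_suminf_wave[OF b] by auto
    show "compact (bad_set b)"
      by (rule compact_bad_set[OF b])
    show "hausdorff_dimension (bad_set b) = of_nat CARD('n)"
      using hausdorff_dimension_bad_set[OF b] by simp
    show "has_fourier_L2 (\<lambda>x. complex_of_real (\<Sum>k. wave b freq k x)) (\<lambda>x. of_real (\<Sum>k. spec b freq k x))"
      by (rule has_fourier_L2_suminf_wave[OF b])
    show "\<forall>x\<in>bad_set b. \<not> lebesgue_point (\<lambda>x. of_real (\<Sum>k. spec b freq k x)) x"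
      using not_lebesgue_point_bad_set[OF b] by blast
  qed
qed

end
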